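(* Suppose that Assumption A (see context) holds, that $\phi$ has the quadrangle scaling property with exponent $\lambda\ge1$ and constants $\tau_1,\tau_2>0$, and let $\pi>0$. Let $\{\gamma_k\}$ be a non-increasing sequence of positive numbers (in particular $\sup_k\gamma_k<\infty$), let $p>1$ with $p\ne\lambda+1$, and let $\mu_k,\nu_k,\eta_k\ge0$ satisfy, for all $k\ge0$, $$\mu_k\le O\left(\frac{1}{(k+1)^p}\right),\quad \nu_k\le O\left(\frac{\gamma_k}{(k+1)^p}\right),\quad \eta_k\le O\left(\frac{\gamma_k}{(k+1)^p}\right).$$ Let $\{\bm{x}^k\}$ and $\{\widetilde{\bm{x}}^k\}$ be the sequences generated by the V-iBPPA (see context), where $\theta_k\in[0,1)$ is chosen such that $\tau_1\gamma_k\theta_k^{\lambda}=\pi c_k(1-\theta_k)$ for all $k\geq 0$, with $c_0:=1$ and $c_k:=\prod_{i=0}^{k-1}(1-\theta_i)$ for $k\ge1$. Then, for any optimal solution $\bm{x}^*$ of $\min\{f(\bm{x}):\bm{x}\in\overline{\mathcal{C}}\}$, $$f(\widetilde{\bm{x}}^{N})-f(\bm{x}^* )\le O\left(\Big(\sum_{k=0}^{N-1}\gamma_k^{-\frac1\lambda}\Big)^{-\lambda}\right)+O\left(\frac{1}{N^{p-1}}\right).$$ In particular, if $0<\underline{\gamma}\le\gamma_k\le\overline{\gamma}<+\infty$ for all $k$ and $p>\lambda+1$, then $$f(\widetilde{\bm{x}}^{N})-f(\bm{x}^* )\le O\left(\frac{1}{N^{\lambda}}\right).$$ (Here $O(\cdot)$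 means up to a constant independent of the index $k\ge0$, respectively $N\ge1$.)
   Context: $\mathbb{E}$ is a real finite-dimensional Euclidean space with inner product $\langle\cdot,\cdot\rangle$ and induced norm $\|\cdot\|$; $f:\mathbb{E}\to(-\infty,\infty]$ is a proper closed convex function with $\mathrm{dom}\,f:=\{\bm{x}: f(\bm{x})<\infty\}$; $\mathcal{C}\subseteq\mathbb{E}$ is a nonempty convex open set with closure $\overline{\mathcal{C}}$. For $\nu\ge0$ and $\bm{x}\in\mathrm{dom}\,f$, the $\nu$-subdifferential is $\partial_\nu f(\bm{x}):=\{\bm{d}: f(\bm{y})\ge f(\bm{x})+\langle \bm{d},\bm{y}-\bm{x}\rangle-\nu\ \ \forall \bm{y}\in\mathbb{E}\}$. A proper closed convex function $\phi$ is essentially smooth if $\mathrm{int}\,\mathrm{dom}\,\phi\neq\emptyset$, $\phi$ is differentiable on $\mathrm{int}\,\mathrm{dom}\,\phi$, and $\|\nabla\phi(\bm{x}_k)\|\to\infty$ for every sequence $\{\bm{x}_k\}$ in $\mathrm{int}\,\mathrm{dom}\,\phi$ converging to a boundary point of $\mathrm{int}\,\mathrm{dom}\,\phi$. The Bregman distance is $\mathcal{D}_\phi(\bm{x},\bm{y}):=\phi(\bm{x})-\phi(\bm{y})-\langle\nabla\phi(\bm{y}),\bm{x}-\bm{y}\rangle$ (for $\phi$ finite at $\bm{x},\bm{y}$ and differentiable at $\bm{y}$). Bregman function with zone $\mathcal{S}$ ($\mathcal{S}$ nonempty open convex): $\phi:\overline{\mathcal{S}}\to\mathbb{R}$ such that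 (B1) $\phi$ is strictly convex and continuous on $\overline{\mathcal{S}}$; (B2) $\phi$ is continuously differentiable on $\mathcal{S}$; (B3) $\{\bm{x}\in\overline{\mathcal{S}}:\mathcal{D}_\phi(\bm{x},\bm{y})\le\alpha\}$ is bounded for every $\bm{y}\in\mathcal{S},\alpha\in\mathbb{R}$, and $\{\bm{y}\in\mathcal{S}:\mathcal{D}_\phi(\bm{x},\bm{y})\le\alpha\}$ is bounded for every $\bm{x}\in\overline{\mathcal{S}},\alpha\in\mathbb{R}$; (B4) if $\{\bm{y}^k\}\subseteq\mathcal{S}$ converges to $\bm{y}^*\in\overline{\mathcal{S}}$, then $\mathcal{D}_\phi(\bm{y}^*,\bm{y}^k)\to0$; (B5) if $\{\bm{x}^k\}\subseteq\overline{\mathcal{S}}$ is bounded, $\{\bm{y}^k\}\subseteq\mathcal{S}$, $\bm{y}^k\to\bm{y}^*$ and $\mathcal{D}_\phi(\bm{x}^k,\bm{y}^k)\to0$, then $\bm{x}^k\to\bm{y}^*$. Assumption A: (i) $\mathrm{dom}\,f\cap\mathcal{C}\ne\emptyset$; (ii) $\rho:=\max\{\|\bm{x}-\bm{y}\|:\bm{x},\bm{y}\in\mathrm{dom}\,f\cap\overline{\mathcal{C}}\}<\infty$; (iii) $\phi:\mathbb{E}\to(-\infty,\infty]$ is proper closed convex with $\mathrm{dom}\,\phi=\overline{\mathcal{C}}$, $\phi$ is a Bregman function with zone $\mathcal{C}$, and $\phi$ is essentially smooth. Quadrangle scaling property with exponent $\lambda\ge1$ and constants $\tau_1,\tau_2>0$: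 for any $\bm{a},\bm{c}\in\mathrm{dom}\,\phi$, $\bm{b},\bm{d}\in\mathrm{int}\,\mathrm{dom}\,\phi$ and $\theta\in[0,1]$, $$\mathcal{D}_{\phi}(\theta\bm{a}+(1-\theta)\bm{c},\theta\bm{b}+(1-\theta)\bm{d})\le\tau_1\theta^{\lambda}\mathcal{D}_{\phi}(\bm{a},\bm{b})+\tau_2(1-\theta)^{\lambda}\mathcal{D}_{\phi}(\bm{c},\bm{d}).$$ V-iBPPA: choose $\bm{x}^0=\widetilde{\bm{x}}^0=\bm{z}^0\in\mathcal{C}$ arbitrarily and set $H_0(\bm{x}):=f(\widetilde{\bm{x}}^0)+\pi\mathcal{D}_\phi(\bm{x},\bm{x}^0)$. For $k=0,1,2,\dots$: Step 1: choose $\theta_k\in[0,1)$ satisfying the equation in the claim and set $\bm{y}^k=\theta_k\bm{z}^k+(1-\theta_k)\bm{x}^k$. Step 2: find $(\bm{x}^{k+1},\widetilde{\bm{x}}^{k+1})$ (by approximately solving $\min_{\bm{x}} f(\bm{x})+\gamma_k\mathcal{D}_\phi(\bm{x},\bm{y}^k)$) such that $\bm{x}^{k+1}\in\mathcal{C}$, $\widetilde{\bm{x}}^{k+1}\in\mathrm{dom}\,f\cap\overline{\mathcal{C}}$ and, for some $\Delta^k\in\mathbb{E}$, $$\Delta^k\in\partial_{\nu_k}f(\widetilde{\bm{x}}^{k+1})+\gamma_k\big(\nabla\phi(\bm{x}^{k+1})-\nabla\phi(\bm{y}^k)\big),\quad\|\Delta^k\|\le\eta_k,\quad\mathcal{D}_\phi(\widetilde{\bm{x}}^{k+1},\bm{x}^{k+1})\le\mu_k.$$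 Step 3: set $$H_{k+1}(\bm{x}):=(1-\theta_k)H_k(\bm{x})+\theta_k\big(f(\widetilde{\bm{x}}^{k+1})+\gamma_k\langle\nabla\phi(\bm{y}^k)-\nabla\phi(\bm{x}^{k+1}),\bm{x}-\widetilde{\bm{x}}^{k+1}\rangle-\rho\eta_k-\nu_k\big)$$ and compute $\bm{z}^{k+1}=\arg\min_{\bm{x}}\{H_{k+1}(\bm{x})\}$ (the unique minimizer, lying in $\mathcal{C}$). *)

theory Defs
  imports "HOL-Analysis.Analysis"
begin

definition edom :: "('a \<Rightarrow> ereal) \<Rightarrow> 'a set" where
  "edom f = {x. f x < \<infinity>}"

definition eepigraph :: "('a \<Rightarrow> ereal) \<Rightarrow> ('a \<times> real) set" where
  "eepigraph f = {(x, r). f x \<le> ereal r}"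

definition proper_closed_convex :: "('a::euclidean_space \<Rightarrow> ereal) \<Rightarrow> bool" where
  "proper_closed_convex f \<longleftrightarrow>
     (\<forall>x. f x \<noteq> -\<infinity>) \<and> edom f \<noteq> {} \<and> closed (eepigraph f) \<and> convex (eepigraph f)"

definition eps_subdifferential ::
    "real \<Rightarrow> ('a::euclidean_space \<Rightarrow> ereal) \<Rightarrow> 'a \<Rightarrow> 'a set" where
  "eps_subdifferential \<nu> f x = {d. \<forall>y. f y \<ge> f x + ereal (d \<bullet> (y - x)) - ereal \<nu>}"

text \<open>Differentiability and gradients of an extended-valued function go through its real part.
  This is only meaningful at interior points of the domain, as the real part is 0 where the
  function is infinite.\<close>

definition ediff_at :: "('a::euclidean_space \<Rightarrow> ereal) \<Rightarrow> 'a \<Rightarrow> bool" where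
  "ediff_at \<phi> x \<longleftrightarrow> (\<lambda>y. real_of_ereal (\<phi> y)) differentiable (at x)"

definition egrad :: "('a::euclidean_space \<Rightarrow> ereal) \<Rightarrow> 'a \<Rightarrow> 'a" where
  "egrad \<phi> x = (THE g. GDERIV (\<lambda>y. real_of_ereal (\<phi> y)) x :> g)"

definition essentially_smooth :: "('a::euclidean_space \<Rightarrow> ereal) \<Rightarrow> bool" where
  "essentially_smooth \<phi> \<longleftrightarrow>
     proper_closed_convex \<phi> \<and>
     interior (edom \<phi>) \<noteq> {} \<and>
     (\<forall>x \<in> interior (edom \<phi>). ediff_at \<phi> x) \<and>
     (\<forall>X b. (\<forall>k. X k \<in> interior (edom \<phi>)) \<longrightarrow> X \<longlonglongrightarrow> b \<longrightarrow>
        b \<in> frontier (interior (edom \<phi>)) \<longrightarrow>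
        filterlim (\<lambda>k. norm (egrad \<phi> (X k))) at_top sequentially)"

text \<open>For \<open>y\<close> in the interior of the domain, the distance is \<open>\<infinity>\<close> as soon as \<open>x\<close> is
  outside the domain.\<close>

definition bregman :: "('a::euclidean_space \<Rightarrow> ereal) \<Rightarrow> 'a \<Rightarrow> 'a \<Rightarrow> ereal" where
  "bregman \<phi> x y = \<phi> x - \<phi> y - ereal (egrad \<phi> y \<bullet> (x - y))"

definition strictly_convex_on :: "'a::real_vector set \<Rightarrow> ('a \<Rightarrow> ereal) \<Rightarrow> bool" where
  "strictly_convex_on S \<phi> \<longleftrightarrow>
     convex S \<and>
     (\<forall>x\<in>S. \<forall>y\<in>S. \<forall>t\<in>{0<..<1}. x \<noteq> y \<longrightarrow>
        \<phi> (t *\<^sub>R x + (1 - t) *\<^sub>R y) < ereal t * \<phi> x + ereal (1 - t) * \<phi> y)"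

definition bregman_function :: "'a::euclidean_space set \<Rightarrow> ('a \<Rightarrow> ereal) \<Rightarrow> bool" where
  "bregman_function S \<phi> \<longleftrightarrow>
     S \<noteq> {} \<and> open S \<and> convex S \<and>
     (\<forall>x \<in> closure S. \<bar>\<phi> x\<bar> \<noteq> \<infinity>) \<and>
     strictly_convex_on (closure S) \<phi> \<and> continuous_on (closure S) \<phi> \<and>
     (\<forall>x\<in>S. ediff_at \<phi> x) \<and> continuous_on S (egrad \<phi>) \<and>
     (\<forall>y\<in>S. \<forall>\<alpha>. bounded {x \<in> closure S. bregman \<phi> x y \<le> ereal \<alpha>}) \<and>
     (\<forall>x\<in>closure S. \<forall>\<alpha>. bounded {y \<in> S. bregman \<phi> x y \<le> ereal \<alpha>}) \<and>
     (\<forall>Y b. (\<forall>k. Y k \<in> S) \<longrightarrow> b \<in> closure S \<longrightarrow> Y \<longlonglongrightarrow> b \<longrightarrow>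
        (\<lambda>k. bregman \<phi> b (Y k)) \<longlonglongrightarrow> 0) \<and>
     (\<forall>X Y b. (\<forall>k. X k \<in> closure S) \<longrightarrow> bounded (range X) \<longrightarrow> (\<forall>k. Y k \<in> S) \<longrightarrow>
        Y \<longlonglongrightarrow> b \<longrightarrow> (\<lambda>k. bregman \<phi> (X k) (Y k)) \<longlonglongrightarrow> 0 \<longrightarrow> X \<longlonglongrightarrow> b)"

definition quadrangle_scaling ::
    "('a::euclidean_space \<Rightarrow> ereal) \<Rightarrow> real \<Rightarrow> real \<Rightarrow> real \<Rightarrow> bool" where
  "quadrangle_scaling \<phi> lam \<tau>1 \<tau>2 \<longleftrightarrow>
     lam \<ge> 1 \<and> \<tau>1 > 0 \<and> \<tau>2 > 0 \<and>
     (\<forall>a \<in> edom \<phi>. \<forall>c \<in> edom \<phi>. \<forall>b \<in> interior (edom \<phi>). \<forall>d \<in> interior (edom \<phi>).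
      \<forall>\<theta>\<in>{0..1}.
        bregman \<phi> (\<theta> *\<^sub>R a + (1 - \<theta>) *\<^sub>R c) (\<theta> *\<^sub>R b + (1 - \<theta>) *\<^sub>R d)
          \<le> ereal (\<tau>1 * \<theta> powr lam) * bregman \<phi> a b
             + ereal (\<tau>2 * (1 - \<theta>) powr lam) * bregman \<phi> c d)"

text \<open>The maximal distance between two feasible points
  is read as a supremum, since \<open>edom f\<close> need not be closed.\<close>

definition feasible_diameter :: "('a::euclidean_space \<Rightarrow> ereal) \<Rightarrow> 'a set \<Rightarrow> real" where
  "feasible_diameter f C = diameter (edom f \<inter> closure C)"

definition assumption_A ::
    "('a::euclidean_space \<Rightarrow> ereal) \<Rightarrow> ('a \<Rightarrow> ereal) \<Rightarrow> 'a set \<Rightarrow> bool" where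
  "assumption_A f \<phi> C \<longleftrightarrow>
     edom f \<inter> C \<noteq> {} \<and>
     bounded (edom f \<inter> closure C) \<and>
     proper_closed_convex \<phi> \<and> edom \<phi> = closure C \<and>
     bregman_function C \<phi> \<and> essentially_smooth \<phi>"

definition V_y :: "(nat \<Rightarrow> real) \<Rightarrow> (nat \<Rightarrow> 'a::euclidean_space) \<Rightarrow> (nat \<Rightarrow> 'a) \<Rightarrow> nat \<Rightarrow> 'a" where
  "V_y \<theta> x z k = \<theta> k *\<^sub>R z k + (1 - \<theta> k) *\<^sub>R x k"

definition V_c :: "(nat \<Rightarrow> real) \<Rightarrow> nat \<Rightarrow> real" where
  "V_c \<theta> k = (\<Prod>i<k. 1 - \<theta> i)"

primrec V_H ::
    "('a::euclidean_space \<Rightarrow> ereal) \<Rightarrow> ('a \<Rightarrow> ereal) \<Rightarrow> 'a set \<Rightarrow> real \<Rightarrow>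
     (nat \<Rightarrow> real) \<Rightarrow> (nat \<Rightarrow> real) \<Rightarrow> (nat \<Rightarrow> real) \<Rightarrow> (nat \<Rightarrow> real) \<Rightarrow>
     (nat \<Rightarrow> 'a) \<Rightarrow> (nat \<Rightarrow> 'a) \<Rightarrow> (nat \<Rightarrow> 'a) \<Rightarrow> nat \<Rightarrow> 'a \<Rightarrow> ereal" where
  "V_H f \<phi> C \<pi> \<gamma> \<theta> \<nu> \<eta> x xt z 0 =
     (\<lambda>w. f (xt 0) + ereal \<pi> * bregman \<phi> w (x 0))"
| "V_H f \<phi> C \<pi> \<gamma> \<theta> \<nu> \<eta> x xt z (Suc k) =
     (\<lambda>w. ereal (1 - \<theta> k) * V_H f \<phi> C \<pi> \<gamma> \<theta> \<nu> \<eta> x xt z k w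
        + ereal (\<theta> k) *
          (f (xt (Suc k))
           + ereal (\<gamma> k * ((egrad \<phi> (V_y \<theta> x z k) - egrad \<phi> (x (Suc k))) \<bullet> (w - xt (Suc k)))
                    - feasible_diameter f C * \<eta> k - \<nu> k)))"

text \<open>In the last clause of \<open>V_iBPPA\<close>, \<open>z (Suc k)\<close> is the unique minimizer over the whole space. That it lies in \<open>C\<close>
  follows from essential smoothness. Uniqueness also forces \<open>f (xt 0)\<close> to be finite: if it were
  \<open>\<infinity>\<close>, all the \<open>V_H\<close> would be identically \<open>\<infinity>\<close> and there would be no
  unique minimizer.\<close>

definition V_iBPPA ::
    "('a::euclidean_space \<Rightarrow> ereal) \<Rightarrow> ('a \<Rightarrow> ereal) \<Rightarrow> 'a set \<Rightarrow> real \<Rightarrow> real \<Rightarrow> real \<Rightarrow>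
     (nat \<Rightarrow> real) \<Rightarrow> (nat \<Rightarrow> real) \<Rightarrow> (nat \<Rightarrow> real) \<Rightarrow> (nat \<Rightarrow> real) \<Rightarrow> (nat \<Rightarrow> real) \<Rightarrow>
     (nat \<Rightarrow> 'a) \<Rightarrow> (nat \<Rightarrow> 'a) \<Rightarrow> (nat \<Rightarrow> 'a) \<Rightarrow> bool" where
  "V_iBPPA f \<phi> C \<pi> lam \<tau>1 \<gamma> \<theta> \<mu> \<nu> \<eta> x xt z \<longleftrightarrow>
     x 0 \<in> C \<and> xt 0 = x 0 \<and> z 0 = x 0 \<and>
     (\<forall>k.
        \<theta> k \<in> {0..<1} \<and>
        \<tau>1 * \<gamma> k * \<theta> k powr lam = \<pi> * V_c \<theta> k * (1 - \<theta> k) \<and>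
        x (Suc k) \<in> C \<and> xt (Suc k) \<in> edom f \<inter> closure C \<and>
        (\<exists>\<Delta> \<in> (\<lambda>d. d + \<gamma> k *\<^sub>R (egrad \<phi> (x (Suc k)) - egrad \<phi> (V_y \<theta> x z k)))
                  ` eps_subdifferential (\<nu> k) f (xt (Suc k)).
           norm \<Delta> \<le> \<eta> k) \<and>
        bregman \<phi> (xt (Suc k)) (x (Suc k)) \<le> ereal (\<mu> k) \<and>
        {w. is_arg_min (V_H f \<phi> C \<pi> \<gamma> \<theta> \<nu> \<eta> x xt z (Suc k)) (\<lambda>_. True) w} = {z (Suc k)})"

end

theory Submission
  imports Defs
begin

text \<open>The functions \<open>H k\<close> form an estimate sequence in the sense of Nesterov. On the feasible
  set their excess over \<open>f\<close> shrinks, because each step averages \<open>H k\<close> with a minorant of \<open>f\<close>: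
  with \<open>c k = V_c \<theta> k\<close> one has \<open>H k w - f w \<le> c k * (H 0 w - f w)\<close>
  (\<open>H_below_objective\<close>). On the other hand the value of \<open>f\<close> at the iterate stays below the
  minimum of \<open>H k\<close>, up to accumulated errors (\<open>objective_below_H_min\<close>):
  \<open>f (xt k) \<le> H k (z k) + c k * (\<Sum>i<k. step_error i / c (i + 1))\<close>.
  Since \<open>H N (z N) \<le> H N xstar\<close> for a minimizer \<open>xstar\<close> of \<open>f\<close>, the gap \<open>f (xt N) - f xstar\<close> is
  at most \<open>c N\<close> times the sum of a constant and the weighted errors (\<open>gap_bound\<close>).

  The second invariant is where the geometry enters. Up to an affine function \<open>H k\<close> is
  \<open>\<pi> * c k * \<phi>\<close>, so around its minimizer it grows exactly like \<open>\<pi> * c k\<close> times the Bregman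
  distance to \<open>z k\<close>. This needs the gradient of \<open>\<phi>\<close> at \<open>z k\<close>, hence \<open>z k \<in> C\<close>, which is
  the effect of essential smoothness (\<open>steep_minimizer_in_interior\<close>). Since
  \<open>\<pi> * c k * (1 - \<theta> k) = \<tau>1 * \<gamma> k * \<theta> k powr lam\<close>, the quadrangle scaling property
  turns this growth into a Bregman distance to the prox centre \<open>y k\<close>, and a four-point identity
  cancels it against the linear term of the new minorant.

  What remains is the behaviour of the step sizes. The equation for \<open>\<theta> k\<close> makes
  \<open>c k powr (- 1 / lam)\<close> grow by at least a multiple of \<open>\<gamma> k powr (- 1 / lam)\<close> in each
  step (\<open>V_c_root_growth\<close>), which gives the rate of \<open>c N\<close>. The same equation reads
  \<open>\<gamma> k / c (k + 1) = \<pi> / (\<tau>1 * \<theta> k powr lam)\<close>, and \<open>\<theta> k\<close> cannot decay faster than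
  \<open>1 / (k + 1)\<close> because \<open>\<gamma>\<close> is non-increasing (\<open>theta_lower\<close>). So the weighted errors are
  of order \<open>(k + 1) powr (lam - p)\<close>. For \<open>p > lam + 1\<close> they are summable and only \<open>c N\<close>
  is left. For \<open>p < lam + 1\<close> their sum is of order \<open>N powr (lam - p + 1)\<close>, which against
  \<open>c N = O(N powr (- lam))\<close> leaves \<open>N powr (1 - p)\<close>. At \<open>p = lam + 1\<close> a logarithm would
  appear.\<close>

section \<open>Step sizes\<close>

text \<open>Bernoulli's inequality for exponents at most one, as an instance of the weighted
  arithmetic-geometric mean inequality.\<close>

lemma powr_one_minus_le:
  fixes h q :: real
  assumes "0 \<le> h" "h \<le> 1" "0 < q" "q \<le> 1"
  shows "(1 - h) powr q \<le> 1 - q * h"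
proof (cases "h = 1")
  case False
  then have "(1 - h) powr q * 1 powr (1 - q) \<le> q * (1 - h) + (1 - q) * 1"
    using assms by (intro Youngs_inequality_0) auto
  then show ?thesis by (simp add: algebra_simps)
qed (use assms in auto)

text \<open>For \<open>s \<ge> 0\<close> every term is at most the last one. For \<open>s < 0\<close> the terms are dominated by
  a telescoping sum, by concavity of \<open>t powr (s + 1)\<close>.\<close>

lemma sum_powr_bound:
  fixes s :: real
  assumes "s > -1"
  shows "\<exists>K\<ge>0. \<forall>N. (\<Sum>k<N. (real k + 1) powr s) \<le> K * real N powr (s + 1)"
proof (cases "s \<ge> 0")
  case True
  have "(\<Sum>k<N. (real k + 1) powr s) \<le> 1 * real N powr (s + 1)" for N
  proof -
    have "(\<Sum>k<N. (real k + 1) powr s) \<le> of_nat (card {..<N}) * real N powr s"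
      using True by (intro sum_bounded_above powr_mono2) auto
    also have "\<dots> = real N powr (s + 1)"
      by (simp add: powr_add)
    finally show ?thesis by simp
  qed
  then show ?thesis by (intro exI[of _ 1]) auto
next
  case False
  define q where "q = s + 1"
  have q: "0 < q" "q \<le> 1" using False assms by (auto simp: q_def)
  have step: "q * (real k + 1) powr s \<le> (real k + 1) powr q - real k powr q" for k
  proof -
    have "real k = (real k + 1) * (1 - 1 / (real k + 1))" by (simp add: field_simps)
    then have "real k powr q = ((real k + 1) * (1 - 1 / (real k + 1))) powr q" by simp
    also have "\<dots> = (real k + 1) powr q * (1 - 1 / (real k + 1)) powr q"
      by (rule powr_mult)
    also have "\<dots> \<le> (real k + 1) powr q * (1 - q * (1 / (real k + 1)))"
      using q by (intro mult_left_mono powr_one_minus_le) auto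
    also have "\<dots> = (real k + 1) powr q - q * ((real k + 1) powr q / (real k + 1))"
      by (simp add: algebra_simps)
    also have "(real k + 1) powr q / (real k + 1) = (real k + 1) powr s"
      by (simp add: q_def powr_add)
    finally show ?thesis by linarith
  qed
  have "(\<Sum>k<N. (real k + 1) powr s) \<le> (1 / q) * real N powr q" for N
  proof -
    have "q * (\<Sum>k<N. (real k + 1) powr s) \<le> (\<Sum>k<N. (real k + 1) powr q - real k powr q)"
      unfolding sum_distrib_left by (intro sum_mono step)
    also have "\<dots> = real N powr q"
      using q sum_lessThan_telescope[of "\<lambda>k. real k powr q" N] by (simp add: add.commute)
    finally show ?thesis using q by (simp add: field_simps)
  qed
  then show ?thesis using q by (intro exI[of _ "1 / q"]) (auto simp: q_def)
qed

locale step_sizes =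
  fixes \<pi> \<tau> lam :: real and \<gamma> \<theta> :: "nat \<Rightarrow> real"
  assumes pi_pos: "\<pi> > 0" and tau_pos: "\<tau> > 0" and lam: "lam \<ge> 1"
    and gamma_pos: "\<gamma> k > 0" and gamma_dec: "decseq \<gamma>"
    and theta_range: "\<theta> k \<in> {0..<1}"
    and theta_eq: "\<tau> * \<gamma> k * \<theta> k powr lam = \<pi> * V_c \<theta> k * (1 - \<theta> k)"
begin

lemma V_c_0 [simp]: "V_c \<theta> 0 = 1"
  by (simp add: V_c_def)

lemma V_c_Suc: "V_c \<theta> (Suc k) = V_c \<theta> k * (1 - \<theta> k)"
  by (simp add: V_c_def)

lemma V_c_pos: "V_c \<theta> k > 0"
  unfolding V_c_def using theta_range by (intro prod_pos) auto

lemma theta_powr: "\<tau> * \<gamma> k * \<theta> k powr lam = \<pi> * V_c \<theta> (Suc k)"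
  by (simp add: V_c_Suc theta_eq)

lemma theta_pos: "\<theta> k > 0"
proof -
  have "\<theta> k \<noteq> 0"
    using theta_powr[of k] V_c_pos[of "Suc k"] pi_pos lam by auto
  then show ?thesis using theta_range[of k] by auto
qed

text \<open>Write \<open>c\<close> and \<open>c'\<close> for two consecutive values. Since \<open>c = c' / (1 - \<theta> k)\<close>,
  concavity gives \<open>c powr (- 1 / lam) \<le> c' powr (- 1 / lam) * (1 - \<theta> k / lam)\<close>, and
  \<open>c' powr (- 1 / lam) * \<theta> k\<close> is known exactly from the step size equation.\<close>

lemma V_c_root_growth:
  "V_c \<theta> N powr (- 1 / lam)
     \<ge> 1 + (\<pi> / \<tau>) powr (1 / lam) / lam * (\<Sum>k<N. \<gamma> k powr (- 1 / lam))"
proof (induction N)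
  case (Suc k)
  let ?c = "V_c \<theta> k" and ?c' = "V_c \<theta> (Suc k)" and ?q = "1 / lam"
  have q: "0 < ?q" "?q \<le> 1" using lam by auto
  have th: "0 < \<theta> k" "\<theta> k < 1" using theta_pos theta_range[of k] by auto
  have c: "?c > 0" "?c' > 0" by (rule V_c_pos)+
  have "?c powr (- ?q) = ?c' powr (- ?q) * (1 - \<theta> k) powr ?q"
    using c th by (simp add: V_c_Suc powr_mult powr_minus)
  also have "\<dots> \<le> ?c' powr (- ?q) * (1 - ?q * \<theta> k)"
    using q th by (intro mult_left_mono powr_one_minus_le) auto
  finally have 1: "?c powr (- ?q) \<le> ?c' powr (- ?q) - ?c' powr (- ?q) * \<theta> k / lam"
    by (simp add: algebra_simps)
  have "\<theta> k powr lam = \<pi> / \<tau> * ?c' * (1 / \<gamma> k)"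
    using theta_powr[of k] tau_pos gamma_pos[of k] by (simp add: field_simps)
  then have "(\<theta> k powr lam) powr ?q = (\<pi> / \<tau> * ?c' * (1 / \<gamma> k)) powr ?q" by simp
  also have "\<dots> = (\<pi> / \<tau>) powr ?q * ?c' powr ?q * \<gamma> k powr (- ?q)"
    using pi_pos tau_pos c gamma_pos[of k] less_imp_le[OF gamma_pos[of k]]
    by (simp add: powr_mult powr_divide powr_minus field_simps)
  finally have "\<theta> k = (\<pi> / \<tau>) powr ?q * ?c' powr ?q * \<gamma> k powr (- ?q)"
    using th lam by (simp add: powr_powr)
  then have "?c' powr (- ?q) * \<theta> k
      = (?c' powr (- ?q) * ?c' powr ?q) * (\<pi> / \<tau>) powr ?q * \<gamma> k powr (- ?q)"
    by simp
  also have "?c' powr (- ?q) * ?c' powr ?q = 1"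
    using c by (simp flip: powr_add)
  finally have "?c' powr (- ?q) * \<theta> k = (\<pi> / \<tau>) powr ?q * \<gamma> k powr (- ?q)" by simp
  with 1 Suc show ?case by (simp add: algebra_simps add_divide_distrib)
qed simp

lemma V_c_rate:
  "\<exists>K\<ge>0. \<forall>N\<ge>1. V_c \<theta> N \<le> K * (\<Sum>k<N. \<gamma> k powr (- 1 / lam)) powr (- lam)"
proof -
  define \<kappa> where "\<kappa> = (\<pi> / \<tau>) powr (1 / lam) / lam"
  have \<kappa>: "\<kappa> > 0" using pi_pos tau_pos lam by (simp add: \<kappa>_def)
  have "V_c \<theta> N \<le> \<kappa> powr (- lam) * (\<Sum>k<N. \<gamma> k powr (- 1 / lam)) powr (- lam)"
    if "N \<ge> 1" for N
  proof -
    let ?S = "\<Sum>k<N. \<gamma> k powr (- 1 / lam)"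
    have S: "?S > 0" using that gamma_pos
      by (intro sum_pos) (auto simp: less_imp_neq[symmetric] lessThan_empty_iff)
    have "\<kappa> * ?S \<le> V_c \<theta> N powr (- 1 / lam)"
      using V_c_root_growth[of N] by (simp add: \<kappa>_def)
    then have "(V_c \<theta> N powr (- 1 / lam)) powr (- lam) \<le> (\<kappa> * ?S) powr (- lam)"
      using \<kappa> S lam by (intro powr_mono2') auto
    then show ?thesis
      using V_c_pos[of N] \<kappa> S lam by (simp add: powr_powr powr_mult)
  qed
  then show ?thesis by (intro exI[of _ "\<kappa> powr (- lam)"]) auto
qed

lemma gamma_sum_rate:
  "\<exists>K\<ge>0. \<forall>N\<ge>1. (\<Sum>k<N. \<gamma> k powr (- 1 / lam)) powr (- lam) \<le> K * real N powr (- lam)"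
proof -
  have "(\<Sum>k<N. \<gamma> k powr (- 1 / lam)) powr (- lam) \<le> \<gamma> 0 * real N powr (- lam)"
    if "N \<ge> 1" for N
  proof -
    have "real N * \<gamma> 0 powr (- 1 / lam) = (\<Sum>k<N. \<gamma> 0 powr (- 1 / lam))" by simp
    also have "\<dots> \<le> (\<Sum>k<N. \<gamma> k powr (- 1 / lam))"
      using lam gamma_pos gamma_dec by (intro sum_mono powr_mono2') (auto simp: decseq_def)
    finally have "(\<Sum>k<N. \<gamma> k powr (- 1 / lam)) powr (- lam)
        \<le> (real N * \<gamma> 0 powr (- 1 / lam)) powr (- lam)"
      using lam that gamma_pos[of 0] by (intro powr_mono2') auto
    also have "\<dots> = \<gamma> 0 * real N powr (- lam)"
      using lam gamma_pos[of 0] by (simp add: powr_mult powr_powr)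
    finally show ?thesis .
  qed
  then show ?thesis using gamma_pos[of 0] by (intro exI[of _ "\<gamma> 0"]) auto
qed

lemma V_c_poly_rate: "\<exists>K\<ge>0. \<forall>N\<ge>1. V_c \<theta> N \<le> K * real N powr (- lam)"
proof -
  obtain K where K: "K \<ge> 0"
    "\<And>N. N \<ge> 1 \<Longrightarrow> V_c \<theta> N \<le> K * (\<Sum>k<N. \<gamma> k powr (- 1 / lam)) powr (- lam)"
    using V_c_rate by blast
  obtain L where L: "L \<ge> 0"
    "\<And>N. N \<ge> 1 \<Longrightarrow> (\<Sum>k<N. \<gamma> k powr (- 1 / lam)) powr (- lam) \<le> L * real N powr (- lam)"
    using gamma_sum_rate by blast
  have "V_c \<theta> N \<le> K * L * real N powr (- lam)" if "N \<ge> 1" for N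
    using K(2)[OF that] mult_left_mono[OF L(2)[OF that] K(1)] by (simp add: mult.assoc)
  then show ?thesis using K L by (intro exI[of _ "K * L"]) auto
qed

text \<open>Monotonicity of \<open>\<gamma>\<close> and the step size equation give
  \<open>\<theta> k powr lam * (1 - \<theta> (k + 1)) \<le> \<theta> (k + 1) powr lam\<close>. If \<open>\<theta> (k + 1)\<close> were below
  \<open>\<theta> 0 / (k + 2)\<close>, then \<open>1 - \<theta> (k + 1)\<close> would exceed
  \<open>(k + 1) / (k + 2)\<close>, which is at least its own power with exponent \<open>lam \<ge> 1\<close>. With the induction
  hypothesis the left side would then exceed \<open>(\<theta> 0 / (k + 2)) powr lam\<close>, a contradiction.\<close>

lemma theta_lower: "\<theta> k \<ge> \<theta> 0 / (real k + 1)"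
proof (induction k)
  case (Suc k)
  let ?t = "\<theta> k" and ?s = "\<theta> (Suc k)" and ?q = "\<theta> 0 / (real k + 2)"
  let ?r = "(real k + 1) / (real k + 2)"
  have t: "0 < ?t" and s: "0 < ?s" "?s < 1" and th0: "0 < \<theta> 0" "\<theta> 0 < 1"
    using theta_pos theta_range by auto
  have "\<tau> * \<gamma> (Suc k) * ?t powr lam * (1 - ?s) \<le> \<tau> * \<gamma> k * ?t powr lam * (1 - ?s)"
    using tau_pos s decseqD[OF gamma_dec, of k "Suc k"]
    by (intro mult_right_mono mult_left_mono) auto
  also have "\<dots> = \<tau> * \<gamma> (Suc k) * ?s powr lam"
    by (simp add: theta_powr[of k] theta_eq[of "Suc k"])
  finally have "\<tau> * \<gamma> (Suc k) * (?t powr lam * (1 - ?s)) \<le> \<tau> * \<gamma> (Suc k) * ?s powr lam"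
    by (simp add: mult.assoc)
  then have key: "?t powr lam * (1 - ?s) \<le> ?s powr lam"
    using tau_pos gamma_pos[of "Suc k"] by simp
  have "?q \<le> ?s"
  proof (rule ccontr)
    assume "\<not> ?q \<le> ?s"
    then have less: "?s < ?q" by simp
    have "?q \<le> 1 / (real k + 2)" using th0 by (simp add: divide_right_mono)
    also have "\<dots> = 1 - ?r" by (simp add: field_simps)
    finally have r: "?r < 1 - ?s" using less by simp
    have "?q = \<theta> 0 / (real k + 1) * ?r" by simp
    also have "\<dots> \<le> ?t * ?r" using Suc by (intro mult_right_mono) auto
    finally have "?q powr lam \<le> (?t * ?r) powr lam" using th0 lam by (intro powr_mono2) auto
    also have "\<dots> = ?t powr lam * ?r powr lam" by (rule powr_mult)
    also have "\<dots> \<le> ?t powr lam * ?r"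
      using lam powr_mono'[of 1 lam ?r] by (intro mult_left_mono) auto
    also have "\<dots> < ?t powr lam * (1 - ?s)" using r t by (intro mult_strict_left_mono) auto
    also have "\<dots> \<le> ?s powr lam" by (rule key)
    also have "\<dots> < ?q powr lam" using less s lam by (intro powr_less_mono2) auto
    finally show False .
  qed
  then show ?case by (simp add: add.commute)
qed simp

text \<open>An error made in step \<open>k\<close> carries the weight \<open>1 / c (k + 1)\<close>. The errors are relative to
  \<open>\<gamma> k\<close>, so this ratio is the quantity that matters.\<close>

lemma error_weight:
  "\<exists>K\<ge>0. \<forall>k. \<gamma> k / V_c \<theta> (Suc k) \<le> K * (real k + 1) powr lam"
proof -
  have "\<gamma> k / V_c \<theta> (Suc k) \<le> \<pi> / \<tau> * \<theta> 0 powr (- lam) * (real k + 1) powr lam" for k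
  proof -
    have "\<gamma> k / V_c \<theta> (Suc k) = \<pi> / \<tau> * \<theta> k powr (- lam)"
      using theta_powr[of k] theta_pos[of k] V_c_pos[of "Suc k"] tau_pos
      by (simp add: powr_minus field_simps)
    also have "\<theta> k powr (- lam) \<le> (\<theta> 0 / (real k + 1)) powr (- lam)"
      using theta_lower[of k] theta_pos[of 0] lam by (intro powr_mono2') auto
    also have "\<dots> = \<theta> 0 powr (- lam) * (real k + 1) powr lam"
      using theta_pos[of 0] by (simp add: powr_divide powr_minus field_simps)
    finally show ?thesis using pi_pos tau_pos by (simp add: mult.assoc mult_left_mono divide_right_mono)
  qed
  then show ?thesis
    using pi_pos tau_pos by (intro exI[of _ "\<pi> / \<tau> * \<theta> 0 powr (- lam)"]) auto
qed

end

section \<open>Gradients and minimizers of convex functions\<close>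

text \<open>Reduction to one variable: restrict \<open>\<phi>\<close> to the line through \<open>y\<close> and \<open>w\<close>. As \<open>y\<close> is
  interior, the parameter \<open>0\<close> is interior to the domain of the restriction, even if \<open>w\<close> is a
  boundary point.\<close>

lemma gradient_inequality:
  fixes \<phi> :: "'a::euclidean_space \<Rightarrow> real"
  assumes cvx: "convex_on S \<phi>" and y: "y \<in> interior S" and w: "w \<in> S"
    and grad: "GDERIV \<phi> y :> g"
  shows "\<phi> y + g \<bullet> (w - y) \<le> \<phi> w"
proof -
  define seg where "seg = (\<lambda>t::real. y + t *\<^sub>R (w - y))"
  define A where "A = seg -` S"
  have aff: "seg (u * s + v * t) = u *\<^sub>R seg s + v *\<^sub>R seg t" if "u + v = 1" for u v s t
  proof -
    have "u *\<^sub>R y + v *\<^sub>R y = y" using that by (simp flip: scaleR_add_left)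
    then show ?thesis by (simp add: seg_def algebra_simps)
  qed
  have S: "convex S" using cvx by (rule convex_on_imp_convex)
  have A: "convex A"
    unfolding convex_def A_def by (auto simp: aff intro!: convexD[OF S])
  have cvxA: "convex_on A (\<lambda>t. \<phi> (seg t))"
    using cvx A unfolding convex_on_def by (auto simp: aff A_def)
  have "open (seg -` interior S)"
    unfolding seg_def by (intro open_vimage continuous_intros) auto
  then have 0: "0 \<in> interior A"
    using y interior_subset[of S] by (intro interiorI[of "seg -` interior S"]) (auto simp: A_def seg_def)
  have "(\<phi> has_derivative (\<lambda>h. h \<bullet> g)) (at (seg 0))"
    using grad by (simp add: gderiv_def seg_def)
  moreover have "(seg has_derivative (\<lambda>t. t *\<^sub>R (w - y))) (at 0)"
    unfolding seg_def by (auto intro!: derivative_eq_intros)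
  ultimately have "((\<lambda>t. \<phi> (seg t)) has_derivative (\<lambda>t. (t *\<^sub>R (w - y)) \<bullet> g)) (at 0)"
    by (rule has_derivative_compose[rotated])
  then have "((\<lambda>t. \<phi> (seg t)) has_field_derivative (g \<bullet> (w - y))) (at 0)"
    unfolding has_field_derivative_def
    by (rule has_derivative_eq_rhs) (simp add: fun_eq_iff inner_commute mult.commute)
  then have "g \<bullet> (w - y) * (1 - 0) \<le> \<phi> (seg 1) - \<phi> (seg 0)"
    using w by (intro convex_on_imp_above_tangent[OF cvxA] convex_connected A 0)
      (auto simp: A_def seg_def intro: has_field_derivative_at_within)
  then show ?thesis by (simp add: seg_def)
qed

lemma minimizer_gradient:
  fixes \<phi> :: "'a::euclidean_space \<Rightarrow> real"
  assumes "open C" "z \<in> C" and grad: "GDERIV \<phi> z :> g"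
    and min: "\<And>w. w \<in> C \<Longrightarrow> \<phi> z + v \<bullet> z \<le> \<phi> w + v \<bullet> w"
  shows "g = - v"
proof -
  have "((\<lambda>w. \<phi> w + v \<bullet> w) has_derivative (\<lambda>h. h \<bullet> g + v \<bullet> h)) (at z)"
    using grad unfolding gderiv_def by (intro derivative_intros)
  then have "(\<lambda>h. h \<bullet> g + v \<bullet> h) = (\<lambda>h. 0)"
    using assms by (intro differential_zero_maxmin[of z C]) auto
  then have "(g + v) \<bullet> g + v \<bullet> (g + v) = 0" by (rule fun_cong)
  then have "(g + v) \<bullet> (g + v) = 0" by (simp add: inner_simps inner_commute)
  then show ?thesis by (simp add: eq_neg_iff_add_eq_0)
qed

text \<open>Suppose that the minimizer \<open>z\<close> were a boundary point, and approach it along the segment from an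
  interior point \<open>c\<close>. The tilted function \<open>\<psi>\<close> does not decrease from \<open>z\<close> towards \<open>c\<close>, so its
  gradients \<open>G\<close> on the segment satisfy \<open>G \<bullet> (c - X k) \<ge> 0\<close>. The gradient inequality at the
  point of \<open>cball c r\<close> lying furthest in direction \<open>G\<close> then gives \<open>r * norm G \<le> M - \<psi> z\<close>
  with \<open>M\<close> an upper bound of \<open>\<psi>\<close> on that ball. So the gradients stay bounded, against steepness.\<close>

lemma steep_minimizer_in_interior:
  fixes \<phi> :: "'a::euclidean_space \<Rightarrow> real"
  assumes C: "open C" "convex C" "C \<noteq> {}"
    and cvx: "convex_on (closure C) \<phi>"
    and grad: "\<And>y. y \<in> C \<Longrightarrow> GDERIV \<phi> y :> g y"
    and steep: "\<And>X b. (\<And>k. X k \<in> C) \<Longrightarrow> X \<longlonglongrightarrow> b \<Longrightarrow> b \<in> frontier C \<Longrightarrow>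
        filterlim (\<lambda>k. norm (g (X k))) at_top sequentially"
    and z: "z \<in> closure C"
    and min: "\<And>w. w \<in> closure C \<Longrightarrow> \<phi> z + v \<bullet> z \<le> \<phi> w + v \<bullet> w"
  shows "z \<in> C"
proof (rule ccontr)
  assume "z \<notin> C"
  then have zf: "z \<in> frontier C" using z C by (simp add: frontier_def interior_open)
  obtain c where c: "c \<in> C" using C by blast
  obtain r where r: "r > 0" "cball c r \<subseteq> C" using c C(1) open_contains_cball by blast
  define \<psi> where "\<psi> = (\<lambda>w. \<phi> w + v \<bullet> w)"
  have gradpsi: "GDERIV \<psi> y :> g y + v" if "y \<in> C" for y
  proof -
    have "(\<psi> has_derivative (\<lambda>h. h \<bullet> g y + v \<bullet> h)) (at y)"
      unfolding \<psi>_def using grad[OF that] unfolding gderiv_def by (intro derivative_intros)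
    then show ?thesis
      unfolding gderiv_def by (simp add: inner_add_right inner_commute[of v])
  qed
  have cvxpsi: "convex_on (closure C) \<psi>"
    unfolding \<psi>_def
  proof (rule convex_on_add[OF cvx])
    show "convex_on (closure C) (\<lambda>w. v \<bullet> w)"
      unfolding convex_on_def using C by (simp add: convex_closure inner_add_right)
  qed
  have "isCont \<psi> y" if "y \<in> C" for y
    using gradpsi[OF that] unfolding gderiv_def by (rule has_derivative_continuous)
  then have "continuous_on C \<psi>" by (intro continuous_at_imp_continuous_on) blast
  then have "compact (\<psi> ` cball c r)"
    using continuous_on_subset[OF _ r(2)] by (intro compact_continuous_image compact_cball)
  then have "bdd_above (\<psi> ` cball c r)"
    by (intro bounded_imp_bdd_above compact_imp_bounded)
  then obtain M where M: "\<And>w. w \<in> cball c r \<Longrightarrow> \<psi> w \<le> M"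
    unfolding bdd_above_def by blast
  define X where "X = (\<lambda>k. z - (1 / real (Suc k)) *\<^sub>R (z - c))"
  have XC: "X k \<in> C" for k
    using mem_interior_closure_convex_shrink[OF C(2) _ z, of c "1 / real (Suc k)"] c C(1)
    by (simp add: X_def interior_open)
  have "X \<longlonglongrightarrow> z - 0 *\<^sub>R (z - c)"
    unfolding X_def by (intro tendsto_intros LIMSEQ_Suc[OF lim_1_over_n])
  then have Xz: "X \<longlonglongrightarrow> z" by simp
  have bound: "r * norm (g (X k) + v) \<le> M - \<psi> z" for k
  proof -
    let ?t = "1 / real (Suc k)" and ?G = "g (X k) + v"
    have t: "0 < ?t" "?t \<le> 1" by auto
    have ineq: "\<psi> (X k) + ?G \<bullet> (w - X k) \<le> \<psi> w" if "w \<in> closure C" for w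
      using XC C that by (intro gradient_inequality[OF cvxpsi _ _ gradpsi])
        (auto simp: convex_interior_closure interior_open)
    have Xcl: "X k \<in> closure C" using XC closure_subset by auto
    have "\<psi> z \<le> \<psi> (X k)" using min[OF Xcl] by (simp add: \<psi>_def)
    moreover have "\<psi> (X k) + ?G \<bullet> (z - X k) \<le> \<psi> z" by (rule ineq[OF z])
    ultimately have "?G \<bullet> (z - X k) \<le> 0" by linarith
    moreover have "z - X k = ?t *\<^sub>R (z - c)" by (simp add: X_def)
    ultimately have "?t * (?G \<bullet> (z - c)) \<le> 0" by (metis inner_scaleR_right)
    then have "?G \<bullet> (z - c) \<le> 0" by (auto simp: divide_le_0_iff)
    then have dir: "?G \<bullet> (c - z) \<ge> 0" by (simp add: inner_diff_right)
    have "c - X k = (1 - ?t) *\<^sub>R (c - z)" by (simp add: X_def algebra_simps)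
    then have dir2: "?G \<bullet> (c - X k) \<ge> 0" using dir t by simp
    \<comment> \<open>As \<open>sgn 0 = 0\<close>, this choice also covers a vanishing gradient.\<close>
    let ?w = "c + r *\<^sub>R sgn ?G"
    have w: "?w \<in> cball c r" using r by (simp add: dist_norm norm_sgn)
    have "?G \<bullet> sgn ?G = norm ?G"
      by (cases "?G = 0")
        (simp_all add: sgn_div_norm power2_norm_eq_inner[symmetric] power2_eq_square)
    then have "?G \<bullet> (?w - X k) = ?G \<bullet> (c - X k) + r * norm ?G"
      by (simp add: inner_simps)
    moreover have "\<psi> (X k) + ?G \<bullet> (?w - X k) \<le> \<psi> ?w"
      using w r(2) closure_subset[of C] by (intro ineq) blast
    ultimately show ?thesis using dir2 \<open>\<psi> z \<le> \<psi> (X k)\<close> M[OF w] by linarith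
  qed
  have le: "norm (g (X k)) \<le> (M - \<psi> z) / r + norm v" for k
  proof -
    have "norm (g (X k)) \<le> norm (g (X k) + v) + norm v"
      using norm_triangle_ineq4[of "g (X k) + v" v] by simp
    also have "norm (g (X k) + v) \<le> (M - \<psi> z) / r"
      using bound[of k] r by (simp add: field_simps)
    finally show ?thesis by simp
  qed
  have "filterlim (\<lambda>k. norm (g (X k))) at_top sequentially"
    using XC Xz zf by (rule steep)
  then have "eventually (\<lambda>k. norm (g (X k)) > (M - \<psi> z) / r + norm v) sequentially"
    by (simp add: filterlim_at_top_dense)
  then show False
    using le by (simp add: not_less[symmetric])
qed

section \<open>The estimate sequence\<close>

definition real_bregman :: "('a::euclidean_space \<Rightarrow> real) \<Rightarrow> ('a \<Rightarrow> 'a) \<Rightarrow> 'a \<Rightarrow> 'a \<Rightarrow> real" where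
  "real_bregman \<phi> g x y = \<phi> x - \<phi> y - g y \<bullet> (x - y)"

lemma bregman_four_point:
  "(g y - g x) \<bullet> (u - w) + real_bregman \<phi> g u y
     = real_bregman \<phi> g u x - real_bregman \<phi> g w x + real_bregman \<phi> g w y"
  by (simp add: real_bregman_def algebra_simps inner_simps)

text \<open>The data of the algorithm after all extended-valued quantities have been replaced by their
  finite values on \<open>closure C\<close>. The set \<open>F\<close> stands for the feasible set. The approximate
  subgradient condition enters only through \<open>minorant\<close>: the residual \<open>\<Delta>\<close> costs at most
  \<open>\<rho> * \<eta> k\<close> when \<open>\<rho>\<close> is the diameter of \<open>F\<close>.\<close>

locale accelerated_run = step_sizes \<pi> \<tau>1 lam \<gamma> \<theta>
  for \<pi> \<tau>1 lam :: real and \<gamma> \<theta> :: "nat \<Rightarrow> real" +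
  fixes f \<phi> :: "'a::euclidean_space \<Rightarrow> real" and g :: "'a \<Rightarrow> 'a" and F C :: "'a set"
    and \<tau>2 \<rho> :: real and \<mu> \<nu> \<eta> :: "nat \<Rightarrow> real"
    and x xt z :: "nat \<Rightarrow> 'a" and H :: "nat \<Rightarrow> 'a \<Rightarrow> real"
  assumes C: "open C" "convex C" and F: "F \<subseteq> closure C"
    and phi_convex: "convex_on (closure C) \<phi>"
    and phi_grad: "y \<in> C \<Longrightarrow> GDERIV \<phi> y :> g y"
    and phi_steep: "(\<And>k. X k \<in> C) \<Longrightarrow> X \<longlonglongrightarrow> b \<Longrightarrow> b \<in> frontier C \<Longrightarrow>
        filterlim (\<lambda>k. norm (g (X k))) at_top sequentially"
    and tau2_pos: "\<tau>2 > 0"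
    and quadrangle: "\<lbrakk>a \<in> closure C; c \<in> closure C; b \<in> C; d \<in> C; t \<in> {0..1}\<rbrakk> \<Longrightarrow>
        real_bregman \<phi> g (t *\<^sub>R a + (1 - t) *\<^sub>R c) (t *\<^sub>R b + (1 - t) *\<^sub>R d)
          \<le> \<tau>1 * t powr lam * real_bregman \<phi> g a b
            + \<tau>2 * (1 - t) powr lam * real_bregman \<phi> g c d"
    and rho_nonneg: "\<rho> \<ge> 0"
    and mu_nonneg: "\<mu> k \<ge> 0" and nu_nonneg: "\<nu> k \<ge> 0" and eta_nonneg: "\<eta> k \<ge> 0"
    and x_in: "x k \<in> C" and xt_in: "xt k \<in> F" and xt_0: "xt 0 = x 0" and z_0: "z 0 = x 0"
    and xt_near: "real_bregman \<phi> g (xt (Suc k)) (x (Suc k)) \<le> \<mu> k"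
    and minorant: "w \<in> F \<Longrightarrow>
        f (xt (Suc k)) + (\<gamma> k * ((g (V_y \<theta> x z k) - g (x (Suc k))) \<bullet> (w - xt (Suc k)))
          - \<rho> * \<eta> k - \<nu> k) \<le> f w"
    and H_0: "w \<in> closure C \<Longrightarrow> H 0 w = f (xt 0) + \<pi> * real_bregman \<phi> g w (x 0)"
    and H_Suc: "w \<in> closure C \<Longrightarrow> H (Suc k) w = (1 - \<theta> k) * H k w + \<theta> k *
        (f (xt (Suc k)) + (\<gamma> k * ((g (V_y \<theta> x z k) - g (x (Suc k))) \<bullet> (w - xt (Suc k)))
          - \<rho> * \<eta> k - \<nu> k))"
    and z_cl: "z (Suc k) \<in> closure C"
    and z_min: "w \<in> closure C \<Longrightarrow> H (Suc k) (z (Suc k)) \<le> H (Suc k) w"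
begin

abbreviation "D \<equiv> real_bregman \<phi> g"

lemma D_nonneg: "w \<in> closure C \<Longrightarrow> y \<in> C \<Longrightarrow> 0 \<le> D w y"
  using gradient_inequality[OF phi_convex _ _ phi_grad, of y w] C
  by (simp add: real_bregman_def convex_interior_closure interior_open)

lemma H_shape: "\<exists>a b. \<forall>w\<in>closure C. H k w = \<pi> * V_c \<theta> k * \<phi> w + a \<bullet> w + b"
proof (induction k)
  case 0
  let ?b = "f (xt 0) - \<pi> * \<phi> (x 0) + \<pi> * (g (x 0) \<bullet> x 0)"
  have "\<forall>w\<in>closure C. H 0 w = \<pi> * V_c \<theta> 0 * \<phi> w + (- (\<pi> *\<^sub>R g (x 0))) \<bullet> w + ?b"
    by (auto simp: H_0 real_bregman_def algebra_simps inner_simps)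
  then show ?case by blast
next
  case (Suc k)
  then obtain a b where ab: "\<And>w. w \<in> closure C \<Longrightarrow> H k w = \<pi> * V_c \<theta> k * \<phi> w + a \<bullet> w + b"
    by blast
  define d where "d = g (V_y \<theta> x z k) - g (x (Suc k))"
  let ?a = "(1 - \<theta> k) *\<^sub>R a + (\<theta> k * \<gamma> k) *\<^sub>R d"
  let ?b = "(1 - \<theta> k) * b + \<theta> k * (f (xt (Suc k)) - \<gamma> k * (d \<bullet> xt (Suc k)) - \<rho> * \<eta> k - \<nu> k)"
  have "H (Suc k) w = \<pi> * V_c \<theta> (Suc k) * \<phi> w + ?a \<bullet> w + ?b" if "w \<in> closure C" for w
    unfolding H_Suc[OF that] ab[OF that] d_def[symmetric]
    by (simp add: V_c_Suc algebra_simps inner_simps)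
  then show ?case by blast
qed

text \<open>By \<open>H_shape\<close>, \<open>z k\<close> minimizes \<open>\<phi>\<close> plus a linear function, so it lies in \<open>C\<close> and its
  gradient is known. The affine part of \<open>H k\<close> is then the one that turns \<open>\<phi>\<close> into the Bregman
  distance to \<open>z k\<close>.\<close>

lemma z_in_and_H_growth:
  "z k \<in> C \<and> (\<forall>w\<in>closure C. H k w = H k (z k) + \<pi> * V_c \<theta> k * D w (z k))"
proof (cases k)
  case 0
  then show ?thesis
    using x_in[of 0] closure_subset[of C] by (auto simp: z_0 H_0 real_bregman_def)
next
  case (Suc j)
  define m where "m = \<pi> * V_c \<theta> k"
  have m: "m > 0" using pi_pos V_c_pos by (simp add: m_def)
  obtain a b where ab: "\<And>w. w \<in> closure C \<Longrightarrow> H k w = m * \<phi> w + a \<bullet> w + b"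
    using H_shape[of k] unfolding m_def by blast
  define v where "v = a /\<^sub>R m"
  have Hv: "H k w = m * (\<phi> w + v \<bullet> w) + b" if "w \<in> closure C" for w
    using ab[OF that] m by (simp add: v_def algebra_simps)
  have zc: "z k \<in> closure C" using z_cl Suc by simp
  have min: "\<phi> (z k) + v \<bullet> z k \<le> \<phi> w + v \<bullet> w" if "w \<in> closure C" for w
    using z_min[OF that, of j] m unfolding Suc[symmetric] Hv[OF zc] Hv[OF that] by simp
  have zC: "z k \<in> C"
  proof (rule steep_minimizer_in_interior[OF C _ phi_convex phi_grad phi_steep zc min])
    show "C \<noteq> {}" using x_in by blast
  qed
  have "g (z k) = - v"
    using closure_subset[of C]
    by (intro minimizer_gradient[OF C(1) zC phi_grad[OF zC]] min) (rule subsetD)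
  then have "\<forall>w\<in>closure C. H k w = H k (z k) + m * D w (z k)"
    by (auto simp: Hv zc real_bregman_def algebra_simps)
  then show ?thesis unfolding m_def by (rule conjI[OF zC])
qed

lemma z_in: "z k \<in> C"
  by (rule z_in_and_H_growth[THEN conjunct1])

lemma y_in: "V_y \<theta> x z k \<in> C"
  using z_in[of k] x_in[of k] theta_range[of k] unfolding V_y_def
  by (intro convexD[OF C(2)]) auto

text \<open>The term \<open>\<mu> (k - 1)\<close> comes from the distance between \<open>xt k\<close> and \<open>x k\<close>, which were
  produced in the previous step. They coincide for \<open>k = 0\<close>.\<close>

definition step_error :: "nat \<Rightarrow> real" where
  "step_error k = \<rho> * \<eta> k + \<nu> k + \<gamma> k * (\<mu> k + \<tau>2 * (if k = 0 then 0 else \<mu> (k - 1)))"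

lemma H_below_objective:
  assumes "w \<in> F"
  shows "H k w - f w \<le> V_c \<theta> k * (H 0 w - f w)"
proof (induction k)
  case (Suc k)
  have w: "w \<in> closure C" using assms F by auto
  have th: "0 \<le> \<theta> k" "\<theta> k < 1" using theta_range[of k] by auto
  have "H (Suc k) w \<le> (1 - \<theta> k) * H k w + \<theta> k * f w"
    unfolding H_Suc[OF w] using th minorant[OF assms, of k] by (intro add_left_mono mult_left_mono) auto
  then have "H (Suc k) w - f w \<le> (1 - \<theta> k) * (H k w - f w)" by (simp add: algebra_simps)
  also have "\<dots> \<le> (1 - \<theta> k) * (V_c \<theta> k * (H 0 w - f w))"
    using th Suc by (intro mult_left_mono) auto
  finally show ?case by (simp add: V_c_Suc algebra_simps)
qed simp

text \<open>The induction step. Apply the definition of \<open>H (k + 1)\<close> at its minimizer, the growth of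
  \<open>H k\<close> around \<open>z k\<close>, the induction hypothesis, and the new minorant at \<open>xt k\<close>. The linear
  terms combine into one at the point \<open>u = \<theta> k *\<^sub>R z (k + 1) + (1 - \<theta> k) *\<^sub>R xt k\<close>, while
  quadrangle scaling bounds the growth term from below by \<open>\<gamma> k * D u y\<close> up to an error. By the
  four-point identity the linear term at \<open>u\<close> plus \<open>\<gamma> k * D u y\<close> is at least \<open>- \<gamma> k * \<mu> k\<close>.\<close>

lemma objective_below_H_min:
  "f (xt k) \<le> H k (z k) + V_c \<theta> k * (\<Sum>i<k. step_error i / V_c \<theta> (Suc i))"
proof (induction k)
  case 0
  have "x 0 \<in> closure C" using x_in closure_subset by auto
  then show ?case by (simp add: H_0 z_0 real_bregman_def)
next
  case (Suc k)
  define y where "y = V_y \<theta> x z k"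
  define L where "L = (\<lambda>w. (g y - g (x (Suc k))) \<bullet> (w - xt (Suc k)))"
  define W where "W = (\<Sum>i<k. step_error i / V_c \<theta> (Suc i))"
  define R where "R = \<rho> * \<eta> k + \<nu> k"
  define m where "m = (if k = 0 then 0 else \<mu> (k - 1))"
  define u where "u = \<theta> k *\<^sub>R z (Suc k) + (1 - \<theta> k) *\<^sub>R xt k"
  let ?z = "z (Suc k)" and ?f = "f (xt (Suc k))" and ?B = "D (z (Suc k)) (z k)"
  have th: "0 \<le> \<theta> k" "\<theta> k < 1" using theta_range[of k] by auto
  have xtc: "xt j \<in> closure C" for j using xt_in F by auto
  have uc: "u \<in> closure C"
    unfolding u_def using th z_cl[of k] xtc[of k] C
    by (intro convexD convex_closure) auto
  have H1: "H (Suc k) ?z = (1 - \<theta> k) * H k ?z + \<theta> k * (?f + \<gamma> k * L ?z - R)"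
    by (simp add: H_Suc[OF z_cl] L_def y_def R_def algebra_simps)
  have growth: "H k ?z = H k (z k) + \<pi> * V_c \<theta> k * ?B"
    using z_in_and_H_growth[of k] z_cl[of k] by blast
  have prev: "?f + \<gamma> k * L (xt k) - R \<le> f (xt k)"
    using minorant[OF xt_in[of k], of k] by (simp add: L_def y_def R_def)
  have IH: "f (xt k) \<le> H k (z k) + V_c \<theta> k * W" using Suc by (simp add: W_def)
  have "(1 - \<theta> k) * (?f + \<gamma> k * L (xt k) - R - V_c \<theta> k * W) \<le> (1 - \<theta> k) * H k (z k)"
    using prev IH th by (intro mult_left_mono) auto
  then have low: "(1 - \<theta> k) * (?f + \<gamma> k * L (xt k) - R - V_c \<theta> k * W)
      + \<tau>1 * \<gamma> k * \<theta> k powr lam * ?B + \<theta> k * (?f + \<gamma> k * L ?z - R) \<le> H (Suc k) ?z"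
    unfolding H1 growth theta_eq by (simp add: algebra_simps)
  have Lu: "L u = \<theta> k * L ?z + (1 - \<theta> k) * L (xt k)"
    by (simp add: L_def u_def algebra_simps inner_simps)
  have "D (xt k) (x k) \<le> m"
    using xt_near[of "k - 1"] by (cases k) (auto simp: m_def xt_0 real_bregman_def)
  moreover have "(1 - \<theta> k) powr lam \<le> 1" using th lam by (intro powr_le1) auto
  moreover have "0 \<le> m" using mu_nonneg by (simp add: m_def)
  ultimately have "(1 - \<theta> k) powr lam * D (xt k) (x k) \<le> 1 * m"
    using D_nonneg[OF xtc x_in] by (intro mult_mono) auto
  then have "\<tau>2 * ((1 - \<theta> k) powr lam * D (xt k) (x k)) \<le> \<tau>2 * m"
    using tau2_pos by simp
  moreover have "D u y \<le> \<tau>1 * \<theta> k powr lam * ?B + \<tau>2 * (1 - \<theta> k) powr lam * D (xt k) (x k)"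
    unfolding u_def y_def V_y_def using th z_cl xtc z_in x_in by (intro quadrangle) auto
  ultimately have quad: "D u y \<le> \<tau>1 * \<theta> k powr lam * ?B + \<tau>2 * m" by (simp add: mult.assoc)
  have "L u + D u y = D u (x (Suc k)) - D (xt (Suc k)) (x (Suc k)) + D (xt (Suc k)) y"
    unfolding L_def by (rule bregman_four_point)
  then have "- \<mu> k \<le> L u + D u y"
    using D_nonneg[OF uc x_in, of "Suc k"] D_nonneg[OF xtc y_in, of "Suc k" k] xt_near[of k]
    by (simp add: y_def)
  then have "- \<mu> k - \<tau>2 * m \<le> L u + \<tau>1 * \<theta> k powr lam * ?B" using quad by simp
  then have "\<gamma> k * (- \<mu> k - \<tau>2 * m) \<le> \<gamma> k * (L u + \<tau>1 * \<theta> k powr lam * ?B)"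
    using gamma_pos[of k] by (intro mult_left_mono) auto
  with low have "?f \<le> H (Suc k) ?z + (1 - \<theta> k) * (V_c \<theta> k * W) + (R + \<gamma> k * (\<mu> k + \<tau>2 * m))"
    by (simp add: Lu algebra_simps)
  moreover have "V_c \<theta> (Suc k) * (\<Sum>i<Suc k. step_error i / V_c \<theta> (Suc i))
      = V_c \<theta> (Suc k) * W + step_error k"
    using V_c_pos[of "Suc k", THEN less_imp_neq] by (simp add: W_def distrib_left)
  moreover have "V_c \<theta> (Suc k) * W = (1 - \<theta> k) * (V_c \<theta> k * W)" by (simp add: V_c_Suc)
  moreover have "step_error k = R + \<gamma> k * (\<mu> k + \<tau>2 * m)"
    by (simp add: step_error_def R_def m_def)
  ultimately show ?case by simp
qed

lemma gap_bound:
  assumes "w \<in> F"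
  shows "f (xt N) - f w
    \<le> V_c \<theta> N * (\<bar>H 0 w - f w\<bar> + (\<Sum>i<N. step_error i / V_c \<theta> (Suc i)))"
proof -
  have w: "w \<in> closure C" using assms F by auto
  have "0 \<le> \<pi> * V_c \<theta> N * D w (z N)"
    using pi_pos V_c_pos[of N] D_nonneg[OF w z_in] by simp
  then have "H N (z N) \<le> H N w"
    using z_in_and_H_growth[of N, THEN conjunct2, THEN bspec, OF w] by linarith
  moreover have "V_c \<theta> N * (H 0 w - f w) \<le> V_c \<theta> N * \<bar>H 0 w - f w\<bar>"
    using V_c_pos[of N] by (intro mult_left_mono) auto
  ultimately show ?thesis
    using objective_below_H_min[of N] H_below_objective[OF assms, of N] by (simp add: distrib_left)
qed

lemma step_error_bound:
  assumes "p > 1"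
    and mu: "\<exists>M. \<forall>k. \<mu> k \<le> M * (1 / (real k + 1) powr p)"
    and nu: "\<exists>M. \<forall>k. \<nu> k \<le> M * (\<gamma> k / (real k + 1) powr p)"
    and eta: "\<exists>M. \<forall>k. \<eta> k \<le> M * (\<gamma> k / (real k + 1) powr p)"
  shows "\<exists>E\<ge>0. \<forall>k. step_error k \<le> E * (\<gamma> k / (real k + 1) powr p)"
proof -
  obtain Mm where Mm: "\<And>k. \<mu> k \<le> Mm * (1 / (real k + 1) powr p)" using mu by blast
  obtain Mn where Mn: "\<And>k. \<nu> k \<le> Mn * (\<gamma> k / (real k + 1) powr p)" using nu by blast
  obtain Me where Me: "\<And>k. \<eta> k \<le> Me * (\<gamma> k / (real k + 1) powr p)" using eta by blast
  have M0: "0 \<le> Mm" "0 \<le> Mn" "0 \<le> Me"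
    using Mm[of 0] Mn[of 0] Me[of 0] mu_nonneg[of 0] nu_nonneg[of 0] eta_nonneg[of 0] gamma_pos[of 0]
    by (auto simp: zero_le_mult_iff dest: order_trans)
  let ?E = "\<rho> * Me + Mn + (Mm + \<tau>2 * (Mm * 2 powr p))"
  have "step_error k \<le> ?E * (\<gamma> k / (real k + 1) powr p)" for k
  proof -
    define m where "m = (if k = 0 then 0 else \<mu> (k - 1))"
    let ?d = "1 / (real k + 1) powr p"
    have "m \<le> Mm * 2 powr p * ?d"
    proof (cases "k = 0")
      case False
      \<comment> \<open>The index shift in \<open>\<mu> (k - 1)\<close> costs a factor \<open>2 powr p\<close>, as \<open>k + 1 \<le> 2 * k\<close>.\<close>
      have "(real k + 1) powr p \<le> (2 * real k) powr p"
        using False assms(1) by (intro powr_mono2) auto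
      then have "1 / real k powr p \<le> 2 powr p * ?d"
        using False by (simp add: powr_mult field_simps)
      then have "Mm * (1 / real k powr p) \<le> Mm * (2 powr p * ?d)"
        using M0 by (intro mult_left_mono) auto
      moreover have "\<mu> (k - 1) \<le> Mm * (1 / real k powr p)"
        using Mm[of "k - 1"] False by (simp add: of_nat_diff)
      ultimately show ?thesis using False by (simp add: m_def)
    qed (use M0 in \<open>simp add: m_def\<close>)
    then have "\<tau>2 * m \<le> \<tau>2 * (Mm * 2 powr p * ?d)" using tau2_pos by (intro mult_left_mono) auto
    from add_mono[OF Mm[of k] this]
    have "\<gamma> k * (\<mu> k + \<tau>2 * m) \<le> \<gamma> k * (Mm * ?d + \<tau>2 * (Mm * 2 powr p * ?d))"
      using gamma_pos[of k] by (intro mult_left_mono) auto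
    moreover have "\<rho> * \<eta> k \<le> \<rho> * (Me * (\<gamma> k / (real k + 1) powr p))"
      using rho_nonneg Me by (intro mult_left_mono) auto
    ultimately have "step_error k \<le> \<rho> * (Me * (\<gamma> k / (real k + 1) powr p))
        + Mn * (\<gamma> k / (real k + 1) powr p) + \<gamma> k * (Mm * ?d + \<tau>2 * (Mm * 2 powr p * ?d))"
      unfolding step_error_def m_def[symmetric] using Mn[of k] by linarith
    also have "\<dots> = ?E * (\<gamma> k / (real k + 1) powr p)" by (simp add: algebra_simps)
    finally show ?thesis .
  qed
  moreover have "0 \<le> ?E" using M0 rho_nonneg tau2_pos by simp
  ultimately show ?thesis by blast
qed

lemma weighted_error_bound:
  assumes "p > 1"
    and "\<exists>M. \<forall>k. \<mu> k \<le> M * (1 / (real k + 1) powr p)"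
    and "\<exists>M. \<forall>k. \<nu> k \<le> M * (\<gamma> k / (real k + 1) powr p)"
    and "\<exists>M. \<forall>k. \<eta> k \<le> M * (\<gamma> k / (real k + 1) powr p)"
  shows "\<exists>E\<ge>0. \<forall>k. step_error k / V_c \<theta> (Suc k) \<le> E * (real k + 1) powr (lam - p)"
proof -
  obtain E where E: "E \<ge> 0" "\<And>k. step_error k \<le> E * (\<gamma> k / (real k + 1) powr p)"
    using step_error_bound[OF assms] by blast
  obtain K where K: "K \<ge> 0" "\<And>k. \<gamma> k / V_c \<theta> (Suc k) \<le> K * (real k + 1) powr lam"
    using error_weight by blast
  have "step_error k / V_c \<theta> (Suc k) \<le> E * K * (real k + 1) powr (lam - p)" for k
  proof -
    have "step_error k / V_c \<theta> (Suc k) \<le> E * (\<gamma> k / (real k + 1) powr p) / V_c \<theta> (Suc k)"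
      using E(2)[of k] V_c_pos[of "Suc k"] by (intro divide_right_mono) auto
    also have "\<dots> = E / (real k + 1) powr p * (\<gamma> k / V_c \<theta> (Suc k))" by simp
    also have "\<dots> \<le> E / (real k + 1) powr p * (K * (real k + 1) powr lam)"
      using E(1) K(2)[of k] by (intro mult_left_mono) auto
    also have "\<dots> = E * K * (real k + 1) powr (lam - p)" by (simp add: powr_diff)
    finally show ?thesis .
  qed
  then show ?thesis using E K by (intro exI[of _ "E * K"]) auto
qed

lemma gap_le_V_c:
  assumes w: "w \<in> F" and p: "p > lam + 1"
    and errs: "\<exists>M. \<forall>k. \<mu> k \<le> M * (1 / (real k + 1) powr p)"
      "\<exists>M. \<forall>k. \<nu> k \<le> M * (\<gamma> k / (real k + 1) powr p)"
      "\<exists>M. \<forall>k. \<eta> k \<le> M * (\<gamma> k / (real k + 1) powr p)"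
  shows "\<exists>G\<ge>0. \<forall>N. f (xt N) - f w \<le> G * V_c \<theta> N"
proof -
  have "p > 1" using p lam by simp
  then obtain E where E: "E \<ge> 0"
    "\<And>k. step_error k / V_c \<theta> (Suc k) \<le> E * (real k + 1) powr (lam - p)"
    using weighted_error_bound errs by blast
  have "summable (\<lambda>k. real k powr (lam - p))" using p by (simp add: summable_real_powr_iff)
  then have sm: "summable (\<lambda>k. (real k + 1) powr (lam - p))"
    using summable_Suc_iff[of "\<lambda>k. real k powr (lam - p)"] by (simp add: add.commute)
  define G where "G = \<bar>H 0 w - f w\<bar> + E * (\<Sum>k. (real k + 1) powr (lam - p))"
  have "f (xt N) - f w \<le> G * V_c \<theta> N" for N
  proof -
    have "(\<Sum>i<N. step_error i / V_c \<theta> (Suc i)) \<le> E * (\<Sum>i<N. (real i + 1) powr (lam - p))"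
      unfolding sum_distrib_left by (intro sum_mono E)
    also have "\<dots> \<le> E * (\<Sum>k. (real k + 1) powr (lam - p))"
      using E(1) sm by (intro mult_left_mono sum_le_suminf) auto
    finally have "V_c \<theta> N * (\<bar>H 0 w - f w\<bar> + (\<Sum>i<N. step_error i / V_c \<theta> (Suc i))) \<le> V_c \<theta> N * G"
      unfolding G_def using V_c_pos[of N] by (intro mult_left_mono add_left_mono) auto
    then show ?thesis using gap_bound[OF w, of N] by (simp add: mult.commute)
  qed
  moreover have "G \<ge> 0"
    unfolding G_def using E(1) sm by (intro add_nonneg_nonneg mult_nonneg_nonneg suminf_nonneg) auto
  ultimately show ?thesis by blast
qed

lemma gap_le_V_c_plus_power:
  assumes w: "w \<in> F" and p: "1 < p" "p < lam + 1"
    and errs: "\<exists>M. \<forall>k. \<mu> k \<le> M * (1 / (real k + 1) powr p)"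
      "\<exists>M. \<forall>k. \<nu> k \<le> M * (\<gamma> k / (real k + 1) powr p)"
      "\<exists>M. \<forall>k. \<eta> k \<le> M * (\<gamma> k / (real k + 1) powr p)"
  shows "\<exists>G\<ge>0. \<exists>B. \<forall>N\<ge>1. f (xt N) - f w \<le> G * V_c \<theta> N + B * (1 / real N powr (p - 1))"
proof -
  obtain E where E: "E \<ge> 0"
    "\<And>k. step_error k / V_c \<theta> (Suc k) \<le> E * (real k + 1) powr (lam - p)"
    using weighted_error_bound[OF p(1) errs] by blast
  obtain Q where Q: "Q \<ge> 0"
    "\<And>N. (\<Sum>k<N. (real k + 1) powr (lam - p)) \<le> Q * real N powr (lam - p + 1)"
    using sum_powr_bound[of "lam - p"] p by auto
  obtain K where K: "K \<ge> 0" "\<And>N. N \<ge> 1 \<Longrightarrow> V_c \<theta> N \<le> K * real N powr (- lam)"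
    using V_c_poly_rate by blast
  have "f (xt N) - f w \<le> \<bar>H 0 w - f w\<bar> * V_c \<theta> N + K * E * Q * (1 / real N powr (p - 1))"
    if N: "N \<ge> 1" for N
  proof -
    have "(\<Sum>i<N. step_error i / V_c \<theta> (Suc i)) \<le> E * (\<Sum>i<N. (real i + 1) powr (lam - p))"
      unfolding sum_distrib_left by (intro sum_mono E)
    also have "\<dots> \<le> E * (Q * real N powr (lam - p + 1))"
      using E(1) Q(2) by (intro mult_left_mono) auto
    finally have "V_c \<theta> N * (\<Sum>i<N. step_error i / V_c \<theta> (Suc i))
        \<le> V_c \<theta> N * (E * (Q * real N powr (lam - p + 1)))"
      using V_c_pos[of N] by (intro mult_left_mono) auto
    also have "\<dots> \<le> K * real N powr (- lam) * (E * (Q * real N powr (lam - p + 1)))"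
      using K(2)[OF N] E Q by (intro mult_right_mono) auto
    also have "\<dots> = K * E * Q * (real N powr (- lam) * real N powr (lam - p + 1))" by simp
    also have "real N powr (- lam) * real N powr (lam - p + 1) = 1 / real N powr (p - 1)"
      by (simp add: powr_minus_divide[symmetric] flip: powr_add)
    finally show ?thesis using gap_bound[OF w, of N] by (simp add: algebra_simps)
  qed
  then show ?thesis by (intro exI[of _ "\<bar>H 0 w - f w\<bar>"]) auto
qed

end

section \<open>From extended-valued to real-valued functions\<close>

text \<open>The adjoint of the derivative, applied to \<open>1\<close>, is the vector that represents it.\<close>

lemma GDERIV_egrad:
  assumes "ediff_at \<phi> y"
  shows "GDERIV (\<lambda>w. real_of_ereal (\<phi> w)) y :> egrad \<phi> y"
proof -
  let ?f = "\<lambda>w. real_of_ereal (\<phi> w)"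
  obtain L where L: "(?f has_derivative L) (at y)"
    using assms unfolding ediff_at_def differentiable_def by blast
  then have "L h = h \<bullet> adjoint L 1" for h
    using adjoint_works[OF has_derivative_linear[OF L], of h 1] by simp
  then have "L = (\<lambda>h. h \<bullet> adjoint L 1)" by (rule ext)
  with L have ex: "GDERIV ?f y :> adjoint L 1"
    unfolding gderiv_def by (rule has_derivative_eq_rhs)
  have uniq: "g = adjoint L 1" if "GDERIV ?f y :> g" for g
  proof -
    have "(\<lambda>h. h \<bullet> g) = (\<lambda>h. h \<bullet> adjoint L 1)"
      using that ex unfolding gderiv_def by (rule has_derivative_unique)
    then have "h \<bullet> g = h \<bullet> adjoint L 1" for h by (rule fun_cong)
    then show ?thesis by (rule iffD1[OF vector_eq_ldot, OF allI])
  qed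
  show ?thesis unfolding egrad_def by (rule theI[of _ "adjoint L 1"]) (fact ex uniq)+
qed

lemma strictly_convex_on_imp_convex_on:
  assumes cvx: "strictly_convex_on S \<phi>" and fin: "\<And>w. w \<in> S \<Longrightarrow> \<bar>\<phi> w\<bar> \<noteq> \<infinity>"
  shows "convex_on S (\<lambda>w. real_of_ereal (\<phi> w))"
  unfolding convex_on_def
proof (intro conjI ballI allI impI)
  show S: "convex S" using cvx by (simp add: strictly_convex_on_def)
  fix a b and u v :: real
  assume ab: "a \<in> S" "b \<in> S" and uv: "0 \<le> u" "0 \<le> v" "u + v = 1"
  let ?r = "\<lambda>w. real_of_ereal (\<phi> w)"
  consider "a = b" | "u = 0" | "v = 0" | "a \<noteq> b" "u \<in> {0<..<1}" using uv by force
  then show "?r (u *\<^sub>R a + v *\<^sub>R b) \<le> u * ?r a + v * ?r b"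
  proof cases
    case 4
    have v: "v = 1 - u" using uv by simp
    have "u *\<^sub>R a + v *\<^sub>R b \<in> S" using convexD[OF S ab uv] .
    then obtain s s1 s2 where "\<phi> (u *\<^sub>R a + v *\<^sub>R b) = ereal s" "\<phi> a = ereal s1" "\<phi> b = ereal s2"
      using fin[OF ab(1)] fin[OF ab(2)] fin[of "u *\<^sub>R a + v *\<^sub>R b"] by auto
    moreover have "\<phi> (u *\<^sub>R a + v *\<^sub>R b) < ereal u * \<phi> a + ereal v * \<phi> b"
      using cvx ab 4 unfolding strictly_convex_on_def v by blast
    ultimately show ?thesis by simp
  qed (use uv in \<open>auto simp flip: scaleR_add_left distrib_right\<close>)
qed

lemma V_H_infinite:
  assumes "V_H f \<phi> C \<pi> \<gamma> \<theta> \<nu> \<eta> x xt z 0 w = \<infinity>"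
    and "\<And>k. \<theta> k \<in> {0..<1}" and "\<And>k. \<bar>f (xt (Suc k))\<bar> \<noteq> \<infinity>"
  shows "V_H f \<phi> C \<pi> \<gamma> \<theta> \<nu> \<eta> x xt z k w = \<infinity>"
proof (induction k)
  case (Suc k)
  then show ?case using assms(2)[of k] by simp
qed (rule assms(1))

lemma proper_closed_convex_not_MInf: "proper_closed_convex f \<Longrightarrow> f w \<noteq> -\<infinity>"
  by (simp add: proper_closed_convex_def)

lemma finite_on_edom: "proper_closed_convex f \<Longrightarrow> w \<in> edom f \<Longrightarrow> \<bar>f w\<bar> \<noteq> \<infinity>"
  using proper_closed_convex_not_MInf[of f w] by (auto simp: edom_def)

lemma eps_subdifferential_minorant:
  fixes f :: "'a::euclidean_space \<Rightarrow> ereal"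
  assumes d: "d \<in> eps_subdifferential \<nu> f a" and fin: "\<bar>f a\<bar> \<noteq> \<infinity>" "\<bar>f w\<bar> \<noteq> \<infinity>"
    and small: "norm (d + v) \<le> \<eta>" and near: "norm (w - a) \<le> \<rho>" and "0 \<le> \<eta>"
  shows "real_of_ereal (f a) + (- v \<bullet> (w - a) - \<rho> * \<eta> - \<nu>) \<le> real_of_ereal (f w)"
proof -
  have "f w \<ge> f a + ereal (d \<bullet> (w - a)) - ereal \<nu>"
    using d by (simp add: eps_subdifferential_def)
  moreover obtain fa fw where fafw: "f a = ereal fa" "f w = ereal fw" using fin by auto
  ultimately have "fa + d \<bullet> (w - a) - \<nu> \<le> fw" by simp
  moreover have "\<bar>(d + v) \<bullet> (w - a)\<bar> \<le> \<eta> * \<rho>"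
    by (rule order_trans[OF Cauchy_Schwarz_ineq2 mult_mono[OF small near \<open>0 \<le> \<eta>\<close> norm_ge_zero]])
  ultimately show ?thesis by (simp add: fafw inner_add_left mult.commute)
qed

text \<open>The point to settle is finiteness. If \<open>f (xt 0)\<close> were infinite, all \<open>H k\<close> would be constantly \<open>\<infinity>\<close>
  and every point a minimizer, contradicting uniqueness of \<open>z 1\<close>. So the \<open>H k\<close> are finite on
  \<open>closure C\<close> and infinite elsewhere, which confines the minimizers \<open>z k\<close> to
  \<open>closure C\<close>.\<close>

lemma V_iBPPA_accelerated_run:
  fixes f \<phi> :: "'a::euclidean_space \<Rightarrow> ereal" and C :: "'a set"
  assumes f: "proper_closed_convex f" and C: "convex C" "open C"
    and A: "assumption_A f \<phi> C"
    and Q: "quadrangle_scaling \<phi> lam \<tau>1 \<tau>2"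
    and pos: "\<pi> > 0" "\<And>k. \<gamma> k > 0" "decseq \<gamma>"
      "\<And>k. \<mu> k \<ge> 0" "\<And>k. \<nu> k \<ge> 0" "\<And>k. \<eta> k \<ge> 0"
    and V: "V_iBPPA f \<phi> C \<pi> lam \<tau>1 \<gamma> \<theta> \<mu> \<nu> \<eta> x xt z"
  shows "accelerated_run \<pi> \<tau>1 lam \<gamma> \<theta> (\<lambda>w. real_of_ereal (f w)) (\<lambda>w. real_of_ereal (\<phi> w))
    (egrad \<phi>) (edom f \<inter> closure C) C \<tau>2 (feasible_diameter f C) \<mu> \<nu> \<eta> x xt z
    (\<lambda>k w. real_of_ereal (V_H f \<phi> C \<pi> \<gamma> \<theta> \<nu> \<eta> x xt z k w))"
proof -
  let ?f = "\<lambda>w. real_of_ereal (f w)" and ?p = "\<lambda>w. real_of_ereal (\<phi> w)"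
  let ?VH = "V_H f \<phi> C \<pi> \<gamma> \<theta> \<nu> \<eta> x xt z" and ?\<rho> = "feasible_diameter f C"
  let ?g = "egrad \<phi>" and ?F = "edom f \<inter> closure C"
  let ?D = "real_bregman ?p ?g"
  have bfun: "bregman_function C \<phi>" and ess: "essentially_smooth \<phi>"
    and dom: "edom \<phi> = closure C" and bdd: "bounded ?F"
    using A by (auto simp: assumption_A_def)
  have intr: "interior (edom \<phi>) = C"
    using C by (simp add: dom convex_interior_closure interior_open)
  have phi_fin: "\<phi> w = ereal (?p w)" if "w \<in> closure C" for w
    using bfun that by (simp add: bregman_function_def ereal_real)
  have phi_inf: "\<phi> w = \<infinity>" if "w \<notin> closure C" for w
    using that unfolding dom[symmetric] edom_def by simp
  have CC: "w \<in> closure C" if "w \<in> C" for w using that closure_subset by auto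
  have breg: "bregman \<phi> w y = ereal (?D w y)" if w: "w \<in> closure C" and y: "y \<in> C" for w y
  proof -
    obtain r s where "\<phi> w = ereal r" "\<phi> y = ereal s"
      using phi_fin[OF w] phi_fin[OF CC[OF y]] by blast
    then show ?thesis by (simp add: bregman_def real_bregman_def)
  qed
  note V' = V[unfolded V_iBPPA_def]
  have x0: "x 0 \<in> C" "xt 0 = x 0" "z 0 = x 0" using V' by simp_all
  note V1 = V'[THEN conjunct2, THEN conjunct2, THEN conjunct2, THEN spec]
  note V2 = V1[THEN conjunct2] note V3 = V2[THEN conjunct2] note V4 = V3[THEN conjunct2]
  note V5 = V4[THEN conjunct2] note V6 = V5[THEN conjunct2] note V7 = V6[THEN conjunct2]
  have th: "\<theta> k \<in> {0..<1}" for k by (rule V1[THEN conjunct1])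
  have th_eq: "\<tau>1 * \<gamma> k * \<theta> k powr lam = \<pi> * V_c \<theta> k * (1 - \<theta> k)" for k
    by (rule V2[THEN conjunct1])
  have xS: "x (Suc k) \<in> C" for k by (rule V3[THEN conjunct1])
  have xtS: "xt (Suc k) \<in> ?F" for k by (rule V4[THEN conjunct1])
  have sub: "\<exists>d \<in> eps_subdifferential (\<nu> k) f (xt (Suc k)).
        norm (d + \<gamma> k *\<^sub>R (?g (x (Suc k)) - ?g (V_y \<theta> x z k))) \<le> \<eta> k" for k
    using V5[of k, THEN conjunct1] by (simp only: bex_simps)
  have near: "bregman \<phi> (xt (Suc k)) (x (Suc k)) \<le> ereal (\<mu> k)" for k
    by (rule V6[THEN conjunct1])
  have argmin: "{w. is_arg_min (?VH (Suc k)) (\<lambda>_. True) w} = {z (Suc k)}" for k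
    by (rule V7)
  have x_in: "x k \<in> C" for k using x0(1) xS by (cases k) simp_all
  have fS: "\<bar>f (xt (Suc k))\<bar> \<noteq> \<infinity>" for k using xtS[of k] by (intro finite_on_edom[OF f]) simp
  have "xt 0 \<in> edom f"
  proof (rule ccontr)
    assume "xt 0 \<notin> edom f"
    then have "?VH 0 w = \<infinity>" for w by (simp add: edom_def)
    then have "?VH (Suc 0) w = \<infinity>" for w using th fS by (rule V_H_infinite)
    then have "is_arg_min (?VH (Suc 0)) (\<lambda>_. True) w" for w
      by (simp add: is_arg_min_def del: V_H.simps)
    then have single: "w = z (Suc 0)" for w using argmin[of 0] by blast
    obtain b :: 'a where "b \<in> Basis" using nonempty_Basis by blast
    then show False using nonzero_Basis single[of 0] single[of b] by metis
  qed
  then have xt_in: "xt k \<in> ?F" for k using x0(1,2) CC[of "x 0"] xtS by (cases k) auto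
  have f0: "\<bar>f (xt 0)\<bar> \<noteq> \<infinity>" using xt_in[of 0] by (intro finite_on_edom[OF f]) simp
  have VH: "?VH k w = ereal (real_of_ereal (?VH k w))" if w: "w \<in> closure C" for k w
  proof -
    have "\<bar>?VH k w\<bar> \<noteq> \<infinity>"
    proof (induction k)
      case 0
      show ?case using f0 by (auto simp: breg[OF w x0(1)])
    next
      case (Suc k)
      then obtain r where r: "?VH k w = ereal r" by auto
      obtain s where "f (xt (Suc k)) = ereal s" using fS[of k] by auto
      then show ?case by (simp add: r)
    qed
    then show ?thesis by (simp add: ereal_real)
  qed
  have VH_inf: "?VH k w = \<infinity>" if w: "w \<notin> closure C" for k w
  proof (rule V_H_infinite)
    have "bregman \<phi> w (x 0) = \<infinity>"
    proof -
      obtain r where "\<phi> (x 0) = ereal r" using phi_fin[OF CC[OF x0(1)]] by blast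
      then show ?thesis by (simp add: bregman_def phi_inf[OF w])
    qed
    then show "?VH 0 w = \<infinity>" using pos(1) f0 by auto
  qed (fact th fS)+
  have VH_Suc: "real_of_ereal (?VH (Suc k) w) = (1 - \<theta> k) * real_of_ereal (?VH k w) + \<theta> k *
        (?f (xt (Suc k)) + (\<gamma> k * ((?g (V_y \<theta> x z k) - ?g (x (Suc k))) \<bullet> (w - xt (Suc k)))
          - ?\<rho> * \<eta> k - \<nu> k))" if w: "w \<in> closure C" for k w
  proof -
    obtain r where r: "?VH k w = ereal r" using VH[OF w] by blast
    obtain s where s: "f (xt (Suc k)) = ereal s" using fS[of k] by auto
    show ?thesis by (simp add: r s)
  qed
  have zmin: "?VH (Suc k) (z (Suc k)) \<le> ?VH (Suc k) w" for k w
  proof -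
    have "is_arg_min (?VH (Suc k)) (\<lambda>_. True) (z (Suc k))" using argmin[of k] by blast
    then show ?thesis by (simp add: is_arg_min_def not_less del: V_H.simps)
  qed
  have z_cl: "z (Suc k) \<in> closure C" for k
  proof (rule ccontr)
    assume "z (Suc k) \<notin> closure C"
    then have "?VH (Suc k) (x 0) = \<infinity>"
      using zmin[of k "x 0"] VH_inf by (simp del: V_H.simps)
    moreover obtain r where "?VH (Suc k) (x 0) = ereal r"
      using VH[OF CC[OF x0(1)], of "Suc k"] by blast
    ultimately show False by (simp del: V_H.simps)
  qed
  show ?thesis
  proof unfold_locales
    show "\<pi> > 0" "\<And>k. \<gamma> k > 0" "decseq \<gamma>" "\<And>k. \<mu> k \<ge> 0" "\<And>k. \<nu> k \<ge> 0" "\<And>k. \<eta> k \<ge> 0"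
      by (fact pos)+
    show "\<tau>1 > 0" "lam \<ge> 1" "\<tau>2 > 0" using Q by (auto simp: quadrangle_scaling_def)
    show "convex_on (closure C) ?p"
      using bfun by (intro strictly_convex_on_imp_convex_on) (auto simp: bregman_function_def)
    show "GDERIV ?p y :> ?g y" if "y \<in> C" for y
      using bfun that by (intro GDERIV_egrad) (auto simp: bregman_function_def)
    show "filterlim (\<lambda>k. norm (?g (X k))) at_top sequentially"
      if "\<And>k. X k \<in> C" "X \<longlonglongrightarrow> b" "b \<in> frontier C" for X b
      using ess that unfolding essentially_smooth_def intr by blast
    show "?D (t *\<^sub>R a + (1 - t) *\<^sub>R c) (t *\<^sub>R b + (1 - t) *\<^sub>R d)
          \<le> \<tau>1 * t powr lam * ?D a b + \<tau>2 * (1 - t) powr lam * ?D c d"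
      if *: "a \<in> closure C" "c \<in> closure C" "b \<in> C" "d \<in> C" "t \<in> {0..1}" for a c b d t
    proof -
      have "t *\<^sub>R a + (1 - t) *\<^sub>R c \<in> closure C" "t *\<^sub>R b + (1 - t) *\<^sub>R d \<in> C"
        using * C by (auto intro!: convexD convex_closure)
      then have "ereal (?D (t *\<^sub>R a + (1 - t) *\<^sub>R c) (t *\<^sub>R b + (1 - t) *\<^sub>R d))
          = bregman \<phi> (t *\<^sub>R a + (1 - t) *\<^sub>R c) (t *\<^sub>R b + (1 - t) *\<^sub>R d)"
        by (simp add: breg)
      also have "\<dots> \<le> ereal (\<tau>1 * t powr lam) * bregman \<phi> a b
          + ereal (\<tau>2 * (1 - t) powr lam) * bregman \<phi> c d"
        using Q * unfolding quadrangle_scaling_def intr unfolding dom by blast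
      finally show ?thesis using * by (simp add: breg)
    qed
    show "?\<rho> \<ge> 0" unfolding feasible_diameter_def by (rule diameter_ge_0[OF bdd])
    show "?D (xt (Suc k)) (x (Suc k)) \<le> \<mu> k" for k
      using near[of k] xtS[of k] xS[of k] by (simp add: breg)
    show "?f (xt (Suc k)) + (\<gamma> k * ((?g (V_y \<theta> x z k) - ?g (x (Suc k))) \<bullet> (w - xt (Suc k)))
          - ?\<rho> * \<eta> k - \<nu> k) \<le> ?f w" if w: "w \<in> ?F" for w k
    proof -
      obtain d where d: "d \<in> eps_subdifferential (\<nu> k) f (xt (Suc k))"
        "norm (d + \<gamma> k *\<^sub>R (?g (x (Suc k)) - ?g (V_y \<theta> x z k))) \<le> \<eta> k"
        using sub[of k] by blast
      have "norm (w - xt (Suc k)) \<le> ?\<rho>"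
        unfolding feasible_diameter_def dist_norm[symmetric]
        by (rule diameter_bounded_bound[OF bdd w xtS])
      then have "?f (xt (Suc k)) + (- (\<gamma> k *\<^sub>R (?g (x (Suc k)) - ?g (V_y \<theta> x z k))) \<bullet> (w - xt (Suc k))
          - ?\<rho> * \<eta> k - \<nu> k) \<le> ?f w"
        using w pos(6) finite_on_edom[OF f] by (intro eps_subdifferential_minorant[OF d(1) fS _ d(2)]) auto
      then show ?thesis by (simp add: inner_diff_left algebra_simps)
    qed
    show "real_of_ereal (?VH 0 w) = ?f (xt 0) + \<pi> * ?D w (x 0)" if "w \<in> closure C" for w
    proof -
      obtain s where "f (xt 0) = ereal s" using f0 by auto
      then show ?thesis by (simp add: breg[OF that x0(1)])
    qed
    show "real_of_ereal (?VH (Suc k) w) = (1 - \<theta> k) * real_of_ereal (?VH k w) + \<theta> k *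
        (?f (xt (Suc k)) + (\<gamma> k * ((?g (V_y \<theta> x z k) - ?g (x (Suc k))) \<bullet> (w - xt (Suc k)))
          - ?\<rho> * \<eta> k - \<nu> k))" if "w \<in> closure C" for k w
      by (rule VH_Suc[OF that])
    show "real_of_ereal (?VH (Suc k) (z (Suc k))) \<le> real_of_ereal (?VH (Suc k) w)"
      if w: "w \<in> closure C" for k w
    proof -
      obtain r s where "?VH (Suc k) w = ereal r" "?VH (Suc k) (z (Suc k)) = ereal s"
        using VH[OF w, of "Suc k"] VH[OF z_cl, of "Suc k" k] by blast
      then show ?thesis using zmin[of k w] by (simp del: V_H.simps)
    qed
    show "?F \<subseteq> closure C" by blast
  qed (fact C th th_eq x_in xt_in x0 z_cl)+
qed

section \<open>The convergence rate\<close>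

theorem theorem5p2:
  fixes f \<phi> :: "'a::euclidean_space \<Rightarrow> ereal" and C :: "'a set"
    and \<pi> lam \<tau>1 \<tau>2 p :: real
    and \<gamma> \<theta> \<mu> \<nu> \<eta> :: "nat \<Rightarrow> real"
    and x xt z :: "nat \<Rightarrow> 'a" and xstar :: 'a
  assumes "proper_closed_convex f"
    and "C \<noteq> {}" and "convex C" and "open C"
    and "assumption_A f \<phi> C"
    and "quadrangle_scaling \<phi> lam \<tau>1 \<tau>2"
    and "\<pi> > 0"
    and "\<And>k. \<gamma> k > 0" and "decseq \<gamma>"
    and "p > 1" and "p \<noteq> lam + 1"
    and "\<And>k. \<mu> k \<ge> 0" and "\<And>k. \<nu> k \<ge> 0" and "\<And>k. \<eta> k \<ge> 0"
    and "\<exists>M. \<forall>k. \<mu> k \<le> M * (1 / (real k + 1) powr p)"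
    and "\<exists>M. \<forall>k. \<nu> k \<le> M * (\<gamma> k / (real k + 1) powr p)"
    and "\<exists>M. \<forall>k. \<eta> k \<le> M * (\<gamma> k / (real k + 1) powr p)"
    and "V_iBPPA f \<phi> C \<pi> lam \<tau>1 \<gamma> \<theta> \<mu> \<nu> \<eta> x xt z"
    and "is_arg_min f (\<lambda>w. w \<in> closure C) xstar"
  shows "(\<exists>A B. \<forall>N\<ge>1.
            f (xt N) - f xstar
              \<le> ereal (A * (\<Sum>k<N. \<gamma> k powr (- 1 / lam)) powr (- lam)
                        + B * (1 / real N powr (p - 1))))
       \<and> (\<forall>lo hi. 0 < lo \<and> (\<forall>k. lo \<le> \<gamma> k \<and> \<gamma> k \<le> hi) \<and> p > lam + 1 \<longrightarrow>
            (\<exists>A. \<forall>N\<ge>1. f (xt N) - f xstar \<le> ereal (A * (1 / real N powr lam))))"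
proof -
  interpret accelerated_run \<pi> \<tau>1 lam \<gamma> \<theta> "\<lambda>w. real_of_ereal (f w)" "\<lambda>w. real_of_ereal (\<phi> w)"
    "egrad \<phi>" "edom f \<inter> closure C" C \<tau>2 "feasible_diameter f C" \<mu> \<nu> \<eta> x xt z
    "\<lambda>k w. real_of_ereal (V_H f \<phi> C \<pi> \<gamma> \<theta> \<nu> \<eta> x xt z k w)"
    using assms by (intro V_iBPPA_accelerated_run)
  let ?f = "\<lambda>w. real_of_ereal (f w)"
  let ?S = "\<lambda>N. (\<Sum>k<N. \<gamma> k powr (- 1 / lam)) powr (- lam)"
  obtain c where "c \<in> edom f" "c \<in> C" using assms(5) by (auto simp: assumption_A_def)
  then have "f xstar \<le> f c" "f c < \<infinity>"
    using assms(19) closure_subset[of C] by (auto simp: is_arg_min_def edom_def not_less)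
  then have xstar: "xstar \<in> edom f \<inter> closure C"
    using assms(19) by (auto simp: is_arg_min_def edom_def)
  have gap: "f (xt N) - f xstar = ereal (?f (xt N) - ?f xstar)" for N
    using finite_on_edom[OF assms(1), of "xt N"] finite_on_edom[OF assms(1), of xstar] xt_in[of N] xstar
    by (metis IntD1 ereal_minus(1) ereal_real)
  have "\<exists>G\<ge>0. \<exists>B. \<forall>N\<ge>1. ?f (xt N) - ?f xstar \<le> G * V_c \<theta> N + B * (1 / real N powr (p - 1))"
  proof (cases "p < lam + 1")
    case True
    then show ?thesis using gap_le_V_c_plus_power[OF xstar assms(10) _ assms(15-17)] by blast
  next
    case False
    then have "p > lam + 1" using assms(11) by simp
    then obtain G where "G \<ge> 0" "\<And>N. ?f (xt N) - ?f xstar \<le> G * V_c \<theta> N"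
      using gap_le_V_c[OF xstar _ assms(15-17)] by blast
    then show ?thesis by (intro exI[of _ G] conjI exI[of _ 0]) auto
  qed
  then obtain G B where G: "G \<ge> 0"
    "\<And>N. N \<ge> 1 \<Longrightarrow> ?f (xt N) - ?f xstar \<le> G * V_c \<theta> N + B * (1 / real N powr (p - 1))"
    by blast
  obtain K where K: "\<And>N. N \<ge> 1 \<Longrightarrow> V_c \<theta> N \<le> K * ?S N" using V_c_rate by blast
  have "f (xt N) - f xstar \<le> ereal (G * K * ?S N + B * (1 / real N powr (p - 1)))" if "N \<ge> 1" for N
    using G(2)[OF that] mult_left_mono[OF K[OF that] G(1)] by (simp add: gap mult.assoc)
  moreover have "\<exists>A. \<forall>N\<ge>1. f (xt N) - f xstar \<le> ereal (A * (1 / real N powr lam))"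
    if p: "p > lam + 1"
  proof -
    obtain G where G: "G \<ge> 0" "\<And>N. ?f (xt N) - ?f xstar \<le> G * V_c \<theta> N"
      using gap_le_V_c[OF xstar p assms(15-17)] by blast
    obtain K where K: "\<And>N. N \<ge> 1 \<Longrightarrow> V_c \<theta> N \<le> K * real N powr (- lam)"
      using V_c_poly_rate by blast
    have "f (xt N) - f xstar \<le> ereal (G * K * (1 / real N powr lam))" if "N \<ge> 1" for N
      using G(2)[of N] mult_left_mono[OF K[OF that] G(1)]
      by (simp add: gap powr_minus_divide)
    then show ?thesis by blast
  qed
  ultimately show ?thesis by blast
qed

end
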